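(* Let $S$ be a Cu-semigroup. Then $\mathrm e_{S,S}\colon[\![S,S]\!]\otimes S\to S$ defines a left action of the Cu-semiring $[\![S,S]\!]$ on $S$.
   Context: A positively ordered semigroup is a commutative monoid $(S,+,0)$ with a partial order $\le$ compatible with addition such that $0\le a$ for all $a$. For $a,b\in S$, $a\ll b$ (way-below) means: whenever $(c_n)_n$ is an increasing sequence in $S$ whose supremum exists and satisfies $b\le\sup_n c_n$, there is $k$ with $a\le c_k$. A Cu-semigroup is a positively ordered semigroup satisfying: (O1) every increasing sequence has a supremum; (O2) every $a$ is the supremum of a sequence $(a_n)_n$ with $a_n\ll a_{n+1}$ for all $n$; (O3) $a'\ll a$ and $b'\ll b$ imply $a'+b'\ll a+b$; (O4) $\sup_n(a_n+b_n)=\sup_n a_n+\sup_n b_n$ for increasing sequences. A generalized Cu-morphism is a map between Cu-semigroups preserving addition, zero, order and suprema of increasing sequences; a Cu-morphism additionally preserves $\ll$. $\mathrm{Cu}[S,T]$ and $\mathrm{Cu}(S,T)$ denote the sets of generalized Cu-morphisms and of Cu-morphisms $S\to T$, with pointwise order and addition. A Cu-bimorphism $\varphi\colon S\times T\to P$ is a map that is additive, zero- and order-preserving in each variable, satisfies $\sup_k\varphi(a_k,b_k)=\varphi(\sup_k a_k,\sup_k b_k)$ for increasing sequences, and satisfies $\varphi(a',b')\ll\varphi(a,b)$ whenever $a'\ll a$ and $b'\ll b$. $S\otimes T$ denotes the Cu-semigroup with universal Cu-bimorphism $S\times T\to S\otimes T$, $(a,b)\mapsto a\otimes b$: every Cu-bimorphism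 $S\times T\to P$ factors through a unique Cu-morphism $S\otimes T\to P$, and Cu-morphisms $\alpha_1,\alpha_2\colon S\otimes T\to P$ satisfy $\alpha_1\le\alpha_2$ iff $\alpha_1(a\otimes b)\le\alpha_2(a\otimes b)$ for all $a,b$. The tensor product is associative up to natural isomorphism. Let $I_{\mathbb Q}=\mathbb Q\cap(0,1)$. For $\varphi,\psi\in\mathrm{Cu}[S,T]$ write $\varphi\prec\psi$ if $\varphi(a')\ll\psi(a)$ whenever $a'\ll a$ in $S$. A path in $\mathrm{Cu}[S,T]$ is a family $\mathbf f=(f_\lambda)_{\lambda\in I_{\mathbb Q}}$ with $f_{\lambda'}\prec f_\lambda$ whenever $\lambda'<\lambda$. Write $\mathbf f\lesssim\mathbf g$ if for every $\lambda$ there is $\mu$ with $f_\lambda\prec g_\mu$. The internal hom $[\![S,T]\!]$ is the set of classes $[\mathbf f]$ of paths modulo ($\mathbf f\lesssim\mathbf g$ and $\mathbf g\lesssim\mathbf f$), with $[\mathbf f]+[\mathbf g]=[(f_\lambda+g_\lambda)_\lambda]$ and $[\mathbf f]\le[\mathbf g]$ iff $\mathbf f\lesssim\mathbf g$; it is a Cu-semigroup. A Cu-morphism $\varphi\colon S\to T$ satisfies $\varphi\prec\varphi$ and is identified with the class of the constant path $(\varphi)_\lambda$ in $[\![S,T]\!]$. The endpoint map $\sigma_{S,T}\colon[\![S,T]\!]\to\mathrm{Cu}[S,T]$ is $\sigma_{S,T}([\mathbf f])(a)=\sup_\lambda f_\lambda(a)$. It is known that for Cu-semigroups $S,T,P$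 there is a bijection $\mathrm{Cu}(S,[\![T,P]\!])\cong\mathrm{Cu}(S\otimes T,P)$ sending $\alpha$ to the Cu-morphism $a\otimes b\mapsto\sigma_{T,P}(\alpha(a))(b)$. The evaluation map $\mathrm e_{S,T}\colon[\![S,T]\!]\otimes S\to T$ is the Cu-morphism corresponding to $\mathrm{id}_{[\![S,T]\!]}$. The composition product $\circ\colon[\![T,P]\!]\otimes[\![S,T]\!]\to[\![S,P]\!]$, $y\otimes x\mapsto y\circ x$, is the Cu-morphism corresponding to $\mathrm e_{T,P}\circ(\mathrm{id}_{[\![T,P]\!]}\otimes\mathrm e_{S,T})\colon[\![T,P]\!]\otimes[\![S,T]\!]\otimes S\to P$. A Cu-semiring is a Cu-semigroup $R$ with an associative Cu-bimorphism $R\times R\to R$, $(r,s)\mapsto rs$, and an element $1\in R$ with $r1=r=1r$ for all $r$ (not necessarily commutative). It is known that $[\![S,S]\!]$ is a Cu-semiring with the composition product and unit $\mathrm{id}_S$. A left action of a Cu-semiring $R$ on a Cu-semigroup $S$ is a Cu-bimorphism $R\times S\to S$, $(r,a)\mapsto ra$ (equivalently, a Cu-morphism $R\otimes S\to S$), such that $(r_1r_2)a=r_1(r_2a)$ and $1a=a$ for all $r_1,r_2\in R$, $a\in S$. *)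

theory Defs
  imports Complex_Main "HOL-Library.Multiset" "HOL-Library.Countable_Set"
begin

section \<open>Cu-semigroups\<close>

context order
begin

definition is_sup :: "'a set \<Rightarrow> 'a \<Rightarrow> bool" where
  "is_sup A s \<longleftrightarrow> (\<forall>x\<in>A. x \<le> s) \<and> (\<forall>u. (\<forall>x\<in>A. x \<le> u) \<longrightarrow> s \<le> u)"

text \<open>Outside this class context, \<open>monotone (\<le>) (\<le>) c\<close> for a sequence \<open>c\<close> is the library's
  \<open>incseq c\<close>; the abbreviation itself is not available inside the class.\<close>

definition way_below :: "'a \<Rightarrow> 'a \<Rightarrow> bool" (infix "\<lless>" 50) where
  "a \<lless> b \<longleftrightarrow>
     (\<forall>(c::nat \<Rightarrow> 'a) s. monotone (\<le>) (\<le>) c \<longrightarrow> is_sup (range c) s \<longrightarrow> b \<le> s \<longrightarrow> (\<exists>k. a \<le> c k))"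

end

definition sup_of :: "'a::order set \<Rightarrow> 'a" where
  "sup_of A = (THE s. is_sup A s)"

class positively_ordered_semigroup = ordered_comm_monoid_add +
  assumes zero_least: "0 \<le> a"

class cu_semigroup = positively_ordered_semigroup +
  assumes O1: "monotone (\<le>) (\<le>) (c::nat \<Rightarrow> 'a) \<Longrightarrow> \<exists>s. is_sup (range c) s"
    and O2: "\<exists>c::nat \<Rightarrow> 'a. (\<forall>n. c n \<lless> c (Suc n)) \<and> is_sup (range c) a"
    and O3: "a' \<lless> a \<Longrightarrow> b' \<lless> b \<Longrightarrow> a' + b' \<lless> a + b"
    and O4: "monotone (\<le>) (\<le>) (c::nat \<Rightarrow> 'a) \<Longrightarrow> monotone (\<le>) (\<le>) (d::nat \<Rightarrow> 'a) \<Longrightarrow>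
      is_sup (range c) s \<Longrightarrow> is_sup (range d) t \<Longrightarrow> is_sup (range (\<lambda>n. c n + d n)) (s + t)"

definition gen_cu_morphism :: "('a::cu_semigroup \<Rightarrow> 'b::cu_semigroup) \<Rightarrow> bool" where
  "gen_cu_morphism f \<longleftrightarrow>
     (\<forall>a b. f (a + b) = f a + f b) \<and> f 0 = 0 \<and> mono f \<and>
     (\<forall>c s. incseq c \<longrightarrow> is_sup (range c) s \<longrightarrow> is_sup (range (\<lambda>n. f (c n))) (f s))"

definition cu_morphism :: "('a::cu_semigroup \<Rightarrow> 'b::cu_semigroup) \<Rightarrow> bool" where
  "cu_morphism f \<longleftrightarrow> gen_cu_morphism f \<and> (\<forall>a' a. a' \<lless> a \<longrightarrow> f a' \<lless> f a)"

text \<open>Generalized Cu-bimorphisms (no condition on the way-below relation) are singled out because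
  they are what is needed to construct the associativity isomorphism of the tensor product.\<close>

definition gen_cu_bimorphism ::
    "('a::cu_semigroup \<Rightarrow> 'b::cu_semigroup \<Rightarrow> 'c::cu_semigroup) \<Rightarrow> bool" where
  "gen_cu_bimorphism f \<longleftrightarrow>
     (\<forall>a a' b. f (a + a') b = f a b + f a' b) \<and> (\<forall>a b b'. f a (b + b') = f a b + f a b') \<and>
     (\<forall>b. f 0 b = 0) \<and> (\<forall>a. f a 0 = 0) \<and>
     (\<forall>b. mono (\<lambda>a. f a b)) \<and> (\<forall>a. mono (f a)) \<and>
     (\<forall>c d s t. incseq c \<longrightarrow> incseq d \<longrightarrow> is_sup (range c) s \<longrightarrow> is_sup (range d) t
        \<longrightarrow> is_sup (range (\<lambda>k. f (c k) (d k))) (f s t))"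

definition cu_bimorphism ::
    "('a::cu_semigroup \<Rightarrow> 'b::cu_semigroup \<Rightarrow> 'c::cu_semigroup) \<Rightarrow> bool" where
  "cu_bimorphism f \<longleftrightarrow> gen_cu_bimorphism f \<and>
     (\<forall>a' a b' b. a' \<lless> a \<longrightarrow> b' \<lless> b \<longrightarrow> f a' b' \<lless> f a b)"


subsection \<open>Basic facts\<close>

lemmas is_sup_iff = is_sup_def

lemma is_supI: "(\<And>x. x \<in> A \<Longrightarrow> x \<le> s) \<Longrightarrow> (\<And>u. (\<And>x. x \<in> A \<Longrightarrow> x \<le> u) \<Longrightarrow> s \<le> u) \<Longrightarrow> is_sup A s"
  by (auto simp: is_sup_iff)

lemma is_sup_upper: "is_sup A s \<Longrightarrow> x \<in> A \<Longrightarrow> x \<le> s"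
  by (auto simp: is_sup_iff)

lemma is_sup_least: "is_sup A s \<Longrightarrow> (\<And>x. x \<in> A \<Longrightarrow> x \<le> u) \<Longrightarrow> s \<le> u"
  by (auto simp: is_sup_iff)

lemma is_sup_unique: "is_sup A s \<Longrightarrow> is_sup A t \<Longrightarrow> s = t"
  by (meson antisym is_sup_least is_sup_upper)

lemma sup_of_eq: "is_sup A s \<Longrightarrow> sup_of A = s"
  unfolding sup_of_def by (blast intro: the_equality is_sup_unique)

lemma is_sup_cofinal:
  assumes "is_sup A s" "\<And>x. x \<in> A \<Longrightarrow> \<exists>y\<in>B. x \<le> y" "\<And>y. y \<in> B \<Longrightarrow> \<exists>x\<in>A. y \<le> x"
  shows "is_sup B s"
proof (rule is_supI)
  show "y \<le> s" if "y \<in> B" for y using assms that by (meson is_sup_upper order_trans)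
  show "s \<le> u" if "\<And>y. y \<in> B \<Longrightarrow> y \<le> u" for u
    using is_sup_least[OF assms(1)] assms(2) that by (meson order_trans)
qed

lemma way_belowD: "a \<lless> b \<Longrightarrow> incseq c \<Longrightarrow> is_sup (range c) s \<Longrightarrow> b \<le> s \<Longrightarrow> \<exists>k. a \<le> c k"
  by (auto simp: way_below_def)

lemma way_below_le: "a \<lless> b \<Longrightarrow> a \<le> b"
  using way_belowD[of a b "\<lambda>_. b" b] by (auto simp: is_sup_iff incseq_def)

lemma way_below_mono: "a \<le> a' \<Longrightarrow> a' \<lless> b' \<Longrightarrow> b' \<le> b \<Longrightarrow> a \<lless> b"
  unfolding way_below_def by (meson order_trans)

lemma way_below_trans: "a \<lless> b \<Longrightarrow> b \<lless> c \<Longrightarrow> a \<lless> c"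
  using way_below_mono way_below_le by blast

lemma zero_way_below: "(0::'a::positively_ordered_semigroup) \<lless> a"
  by (auto simp: way_below_def zero_least)

lemma le_zero: "(a::'a::positively_ordered_semigroup) \<le> 0 \<Longrightarrow> a = 0"
  by (simp add: antisym zero_least)

lemma sum_mono_cu: "a \<le> a' \<Longrightarrow> b \<le> b' \<Longrightarrow> a + b \<le> a' + (b'::'a::cu_semigroup)"
  by (rule add_mono)

text \<open>A fixed choice of a rapidly increasing sequence with supremum \<open>a\<close>.\<close>

definition approx_seq :: "'a::cu_semigroup \<Rightarrow> nat \<Rightarrow> 'a" where
  "approx_seq a = (SOME c. (\<forall>n. c n \<lless> c (Suc n)) \<and> is_sup (range c) a)"

lemma approx_seq_step: "approx_seq a n \<lless> approx_seq a (Suc n)"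
  and approx_seq_sup: "is_sup (range (approx_seq a)) a"
  unfolding approx_seq_def using someI_ex[OF O2[of a]] by auto

lemma approx_seq_incseq: "incseq (approx_seq a)"
  by (simp add: incseq_SucI approx_seq_step way_below_le)

lemma approx_seq_below: "approx_seq a n \<lless> a"
  using approx_seq_step[of a n] is_sup_upper[OF approx_seq_sup]
  by (meson order_refl rangeI way_below_mono)

lemma way_below_approx: "b \<lless> a \<Longrightarrow> \<exists>n. b \<le> approx_seq a n"
  using way_belowD[OF _ approx_seq_incseq approx_seq_sup] by blast

lemma way_below_interpolate:
  fixes a b :: "'a::cu_semigroup"
  assumes "b \<lless> a" obtains c where "b \<lless> c" "c \<lless> a"
proof -
  obtain n where "b \<le> approx_seq a n" using way_below_approx[OF assms] ..
  then have "b \<lless> approx_seq a (Suc n)" using approx_seq_step way_below_mono by blast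
  then show thesis using that approx_seq_below by blast
qed

lemma le_if_way_below:
  fixes a b :: "'a::cu_semigroup"
  assumes "\<And>a'. a' \<lless> a \<Longrightarrow> a' \<le> b" shows "a \<le> b"
  using is_sup_least[OF approx_seq_sup[of a]] assms approx_seq_below by blast

lemma gen_cu_morphismD:
  assumes "gen_cu_morphism f"
  shows "f (a + b) = f a + f b" "f 0 = 0" "a \<le> b \<Longrightarrow> f a \<le> f b"
    "incseq c \<Longrightarrow> is_sup (range c) s \<Longrightarrow> is_sup (range (\<lambda>n. f (c n))) (f s)"
  using assms by (auto simp: gen_cu_morphism_def mono_def)

lemma cu_morphismD:
  assumes "cu_morphism f"
  shows "gen_cu_morphism f" "a' \<lless> a \<Longrightarrow> f a' \<lless> f a"
  using assms by (auto simp: cu_morphism_def)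

lemma gen_cu_bimorphismD:
  assumes "gen_cu_bimorphism f"
  shows "f (a + a') b = f a b + f a' b" "f a (b + b') = f a b + f a b'"
    "f 0 b = 0" "f a 0 = 0"
    "a \<le> a' \<Longrightarrow> b \<le> b' \<Longrightarrow> f a b \<le> f a' b'"
    "incseq c \<Longrightarrow> incseq d \<Longrightarrow> is_sup (range c) s \<Longrightarrow> is_sup (range d) t
       \<Longrightarrow> is_sup (range (\<lambda>k. f (c k) (d k))) (f s t)"
proof -
  show "f a b \<le> f a' b'" if "a \<le> a'" "b \<le> b'"
  proof -
    have "f a b \<le> f a' b" "f a' b \<le> f a' b'"
      using assms that by (simp_all add: gen_cu_bimorphism_def mono_def)
    then show ?thesis by (rule order_trans)
  qed
qed (use assms in \<open>simp_all add: gen_cu_bimorphism_def\<close>)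

lemma cu_bimorphismD:
  assumes "cu_bimorphism f"
  shows "gen_cu_bimorphism f" "a' \<lless> a \<Longrightarrow> b' \<lless> b \<Longrightarrow> f a' b' \<lless> f a b"
  using assms by (auto simp: cu_bimorphism_def)

lemma gen_cu_morphism_id: "gen_cu_morphism (\<lambda>x. x)"
  by (auto simp: gen_cu_morphism_def mono_def)

lemma cu_morphism_id: "cu_morphism id"
  by (auto simp: cu_morphism_def gen_cu_morphism_def mono_def)

lemma gen_cu_morphism_zero: "gen_cu_morphism (\<lambda>_. 0)"
  by (auto simp: gen_cu_morphism_def mono_def is_sup_iff)

lemma gen_cu_morphism_add:
  assumes f: "gen_cu_morphism f" and g: "gen_cu_morphism g"
  shows "gen_cu_morphism (\<lambda>a. f a + g a)"
proof -
  have "is_sup (range (\<lambda>n. f (c n) + g (c n))) (f s + g s)"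
    if "incseq c" "is_sup (range c) s" for c s
    using that gen_cu_morphismD(3,4)[OF f] gen_cu_morphismD(3,4)[OF g]
    by (intro O4) (auto simp: incseq_def)
  then show ?thesis
    using gen_cu_morphismD[OF f] gen_cu_morphismD[OF g]
    by (auto simp: gen_cu_morphism_def mono_def sum_mono_cu algebra_simps)
qed


section \<open>The internal hom\<close>

definition I\<^sub>Q :: "rat set" where
  "I\<^sub>Q = {0<..<1}"

definition morph_below :: "('a::cu_semigroup \<Rightarrow> 'b::cu_semigroup) \<Rightarrow> ('a \<Rightarrow> 'b) \<Rightarrow> bool"
    (infix "\<prec>" 50) where
  "\<phi> \<prec> \<psi> \<longleftrightarrow> (\<forall>a' a. a' \<lless> a \<longrightarrow> \<phi> a' \<lless> \<psi> a)"

text \<open>A family indexed by \<open>I\<^sub>Q\<close> is represented by a function on all rationals. Its values outside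
  \<open>I\<^sub>Q\<close> are unconstrained, and they do not influence the class of a path in the internal hom.\<close>

definition cu_path :: "(rat \<Rightarrow> 'a::cu_semigroup \<Rightarrow> 'b::cu_semigroup) \<Rightarrow> bool" where
  "cu_path f \<longleftrightarrow> (\<forall>l\<in>I\<^sub>Q. gen_cu_morphism (f l)) \<and> (\<forall>l'\<in>I\<^sub>Q. \<forall>l\<in>I\<^sub>Q. l' < l \<longrightarrow> f l' \<prec> f l)"

definition path_le ::
    "(rat \<Rightarrow> 'a::cu_semigroup \<Rightarrow> 'b::cu_semigroup) \<Rightarrow> (rat \<Rightarrow> 'a \<Rightarrow> 'b) \<Rightarrow> bool"
    (infix "\<lesssim>" 50) where
  "f \<lesssim> g \<longleftrightarrow> (\<forall>l\<in>I\<^sub>Q. \<exists>m\<in>I\<^sub>Q. f l \<prec> g m)"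

definition path_equiv ::
    "(rat \<Rightarrow> 'a::cu_semigroup \<Rightarrow> 'b::cu_semigroup) \<Rightarrow> (rat \<Rightarrow> 'a \<Rightarrow> 'b) \<Rightarrow> bool" where
  "path_equiv f g \<longleftrightarrow> cu_path f \<and> cu_path g \<and> f \<lesssim> g \<and> g \<lesssim> f"

lemma morph_belowD: "\<phi> \<prec> \<psi> \<Longrightarrow> a' \<lless> a \<Longrightarrow> \<phi> a' \<lless> \<psi> a"
  by (auto simp: morph_below_def)

lemma morph_below_trans: "\<phi> \<prec> \<psi> \<Longrightarrow> \<psi> \<prec> \<chi> \<Longrightarrow> \<phi> \<prec> \<chi>"
  unfolding morph_below_def by (meson way_below_interpolate way_below_trans)

lemma morph_below_le:
  assumes "gen_cu_morphism \<phi>" "gen_cu_morphism \<psi>" "\<phi> \<prec> \<psi>" shows "\<phi> a \<le> \<psi> a"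
proof -
  have "is_sup (range (\<lambda>n. \<phi> (approx_seq a n))) (\<phi> a)"
    using assms(1) approx_seq_incseq approx_seq_sup gen_cu_morphismD(4) by blast
  then show ?thesis
    by (rule is_sup_least) (use morph_belowD[OF assms(3)] approx_seq_below way_below_le in blast)
qed

lemma morph_below_add: "\<phi> \<prec> \<psi> \<Longrightarrow> \<phi>' \<prec> \<psi>' \<Longrightarrow> (\<lambda>a. \<phi> a + \<phi>' a) \<prec> (\<lambda>a. \<psi> a + \<psi>' a)"
  by (auto simp: morph_below_def O3)

lemma cu_pathD:
  assumes "cu_path f"
  shows "l \<in> I\<^sub>Q \<Longrightarrow> gen_cu_morphism (f l)" "l' \<in> I\<^sub>Q \<Longrightarrow> l \<in> I\<^sub>Q \<Longrightarrow> l' < l \<Longrightarrow> f l' \<prec> f l"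
  using assms by (auto simp: cu_path_def)

lemma IQ_above: assumes "l \<in> I\<^sub>Q" obtains m where "m \<in> I\<^sub>Q" "l < m"
  using assms dense[of l 1] unfolding I\<^sub>Q_def by auto

lemma path_le_trans: "f \<lesssim> g \<Longrightarrow> g \<lesssim> h \<Longrightarrow> f \<lesssim> h"
  unfolding path_le_def by (meson morph_below_trans)

lemma path_le_refl: "cu_path f \<Longrightarrow> f \<lesssim> f"
  unfolding path_le_def by (meson IQ_above cu_pathD(2))

lemma path_le_two:
  assumes "cu_path g" "l \<in> I\<^sub>Q" "m \<in> I\<^sub>Q" "\<phi> \<prec> g l" "\<psi> \<prec> g m"
  obtains n where "n \<in> I\<^sub>Q" "\<phi> \<prec> g n" "\<psi> \<prec> g n"
proof -
  obtain n where "n \<in> I\<^sub>Q" "max l m < n" using IQ_above[of "max l m"] assms by (metis max_def)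
  then show thesis using assms that by (metis cu_pathD(2) max_less_iff_conj morph_below_trans)
qed

lemma cu_path_zero: "cu_path (\<lambda>_ _. 0)"
  by (auto simp: cu_path_def gen_cu_morphism_zero morph_below_def zero_way_below)

lemma cu_path_add: "cu_path f \<Longrightarrow> cu_path g \<Longrightarrow> cu_path (\<lambda>l a. f l a + g l a)"
  by (auto simp: cu_path_def gen_cu_morphism_add morph_below_add)

lemma path_le_add:
  assumes "cu_path f'" "cu_path g'" "f \<lesssim> f'" "g \<lesssim> g'"
  shows "(\<lambda>l a. f l a + g l a) \<lesssim> (\<lambda>l a. f' l a + g' l a)"
  unfolding path_le_def
proof
  fix l assume "l \<in> I\<^sub>Q"
  then obtain m n where mn: "m \<in> I\<^sub>Q" "n \<in> I\<^sub>Q" "f l \<prec> f' m" "g l \<prec> g' n"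
    using assms unfolding path_le_def by blast
  then obtain k where k: "k \<in> I\<^sub>Q" "max m n < k" using IQ_above[of "max m n"] by (metis max_def)
  then have "f l \<prec> f' k" "g l \<prec> g' k"
    using mn assms by (metis cu_pathD(2) max_less_iff_conj morph_below_trans)+
  then show "\<exists>k\<in>I\<^sub>Q. (\<lambda>a. f l a + g l a) \<prec> (\<lambda>a. f' k a + g' k a)"
    using k morph_below_add by blast
qed

quotient_type (overloaded) ('a, 'b) ihom =
    "rat \<Rightarrow> 'a::cu_semigroup \<Rightarrow> 'b::cu_semigroup" / partial: path_equiv
proof (rule part_equivpI)
  show "\<exists>f::rat \<Rightarrow> 'a \<Rightarrow> 'b. path_equiv f f"
    using cu_path_zero path_le_refl unfolding path_equiv_def by blast
  show "symp (path_equiv :: (rat \<Rightarrow> 'a \<Rightarrow> 'b) \<Rightarrow> _)"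
    by (auto simp: symp_def path_equiv_def)
  show "transp (path_equiv :: (rat \<Rightarrow> 'a \<Rightarrow> 'b) \<Rightarrow> _)"
    by (auto simp: transp_def path_equiv_def intro: path_le_trans)
qed

lemma path_equiv_refl: "path_equiv f f \<longleftrightarrow> cu_path f"
  by (auto simp: path_equiv_def path_le_refl)

instantiation ihom :: (cu_semigroup, cu_semigroup) positively_ordered_semigroup
begin

lift_definition less_eq_ihom :: "('a, 'b) ihom \<Rightarrow> ('a, 'b) ihom \<Rightarrow> bool" is path_le
  unfolding path_equiv_def by (meson path_le_trans)

definition less_ihom :: "('a, 'b) ihom \<Rightarrow> ('a, 'b) ihom \<Rightarrow> bool" where
  "less_ihom x y \<longleftrightarrow> x \<le> y \<and> \<not> y \<le> x"

lift_definition zero_ihom :: "('a, 'b) ihom" is "\<lambda>_ _. 0"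
  by (simp add: path_equiv_refl cu_path_zero)

lift_definition plus_ihom :: "('a, 'b) ihom \<Rightarrow> ('a, 'b) ihom \<Rightarrow> ('a, 'b) ihom"
  is "\<lambda>f g l a. f l a + g l a"
  by (auto simp: path_equiv_def cu_path_add path_le_add)

instance
proof
  fix x y z :: "('a, 'b) ihom"
  show "(x < y) = (x \<le> y \<and> \<not> y \<le> x)" by (simp add: less_ihom_def)
  show "x \<le> x" by transfer (simp add: path_equiv_refl path_le_refl)
  show "x \<le> z" if "x \<le> y" "y \<le> z" using that by transfer (rule path_le_trans)
  show "x = y" if "x \<le> y" "y \<le> x" using that
    by transfer (simp add: path_equiv_refl, simp add: path_equiv_def)
  show "x + y + z = x + (y + z)"
    by transfer (simp add: add.assoc path_equiv_refl cu_path_add)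
  show "x + y = y + x"
    by transfer (simp add: add.commute path_equiv_refl cu_path_add)
  show "0 + x = x" by transfer simp
  show "z + x \<le> z + y" if "x \<le> y" using that
    by transfer (auto simp: path_equiv_refl path_le_refl path_le_add)
  show "0 \<le> x" by transfer (auto simp: path_le_def morph_below_def zero_way_below)
qed

end


subsection \<open>The internal hom is a Cu-semigroup\<close>

lemma ihom_cases:
  obtains f where "cu_path f" "x = abs_ihom f"
  by (metis Quotient3_def Quotient3_ihom path_equiv_refl)

lemma ihom_le: "cu_path f \<Longrightarrow> cu_path g \<Longrightarrow> abs_ihom f \<le> abs_ihom g \<longleftrightarrow> f \<lesssim> g"
  by (simp add: less_eq_ihom.abs_eq path_equiv_refl)

lemma ihom_add:
  "cu_path f \<Longrightarrow> cu_path g \<Longrightarrow> abs_ihom f + abs_ihom g = abs_ihom (\<lambda>l a. f l a + g l a)"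
  by (simp add: plus_ihom.abs_eq path_equiv_refl)

lemma IQ_less_cut:
  assumes "l \<in> I\<^sub>Q" "1 / (1 - l) < of_nat n" shows "l < 1 - 1 / (of_nat n + 2)"
proof -
  have l: "0 < 1 - l" using assms(1) by (simp add: I\<^sub>Q_def)
  then have "1 < of_nat n * (1 - l)" using assms(2) by (simp add: pos_divide_less_eq)
  also have "\<dots> \<le> (of_nat n + 2) * (1 - l)" using l by (intro mult_right_mono) auto
  finally have "1 / (of_nat n + 2) < 1 - l" by (simp add: pos_divide_less_eq mult.commute add_pos_pos)
  then show ?thesis by simp
qed

lemma sup_path:
  assumes F: "\<And>k. cu_path (F k)" and step: "\<And>k. F k \<lesssim> F (Suc k)"
  obtains H where "cu_path H" "\<And>k. F k \<lesssim> H" "\<And>l. l \<in> I\<^sub>Q \<Longrightarrow> \<exists>k. \<exists>m\<in>I\<^sub>Q. H l = F k m"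
proof -
  have F_mono: "F j \<lesssim> F k" if "j \<le> k" for j k
    using that by (induction k rule: dec_induct) (auto intro: F path_le_refl path_le_trans step)
  define r :: "nat \<Rightarrow> rat" where "r k = 1 - 1 / (of_nat k + 2)" for k
  have r: "r k \<in> I\<^sub>Q" for k by (auto simp: r_def I\<^sub>Q_def field_simps)
  have mid: "(x + 1) / 2 \<in> I\<^sub>Q" "x < (x + 1) / 2" if "x \<in> I\<^sub>Q" for x
    using that by (auto simp: I\<^sub>Q_def)
  have "\<exists>\<mu>::nat \<Rightarrow> rat. \<forall>k. (\<mu> k \<in> I\<^sub>Q \<and> r k \<le> \<mu> k) \<and>
      (\<mu> k < \<mu> (Suc k) \<and> (\<forall>j\<le>k. F j ((\<mu> k + 1) / 2) \<prec> F (Suc k) (\<mu> (Suc k))))"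
  proof (rule dependent_nat_choice)
    show "\<exists>x. x \<in> I\<^sub>Q \<and> r 0 \<le> x" using r by blast
    fix x k assume x: "x \<in> I\<^sub>Q \<and> r k \<le> x"
    have "\<exists>m\<in>I\<^sub>Q. F j ((x + 1) / 2) \<prec> F (Suc k) m" if "j \<le> k" for j
      using F_mono[of j "Suc k"] that mid x unfolding path_le_def by auto
    then obtain m where m: "\<And>j. j \<le> k \<Longrightarrow> m j \<in> I\<^sub>Q \<and> F j ((x + 1) / 2) \<prec> F (Suc k) (m j)"
      by metis
    have "Max (insert x (insert (r (Suc k)) (m ` {..k}))) \<in> insert x (insert (r (Suc k)) (m ` {..k}))"
      by (rule Max_in) auto
    then have "Max (insert x (insert (r (Suc k)) (m ` {..k}))) \<in> I\<^sub>Q" using x r m by auto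
    then obtain y where y: "y \<in> I\<^sub>Q" "Max (insert x (insert (r (Suc k)) (m ` {..k}))) < y"
      using IQ_above by blast
    then have yl: "x < y" "r (Suc k) < y" "\<And>j. j \<le> k \<Longrightarrow> m j < y" by auto
    have "F j ((x + 1) / 2) \<prec> F (Suc k) y" if "j \<le> k" for j
      using m[OF that] yl(3)[OF that] y F cu_pathD(2) morph_below_trans by blast
    then show "\<exists>y. (y \<in> I\<^sub>Q \<and> r (Suc k) \<le> y) \<and>
        (x < y \<and> (\<forall>j\<le>k. F j ((x + 1) / 2) \<prec> F (Suc k) y))"
      using y yl by (intro exI[of _ y]) auto
  qed
  then obtain \<mu> :: "nat \<Rightarrow> rat" where \<mu>: "\<And>k. \<mu> k \<in> I\<^sub>Q" "\<And>k. r k \<le> \<mu> k" "\<And>k. \<mu> k < \<mu> (Suc k)"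
    and \<mu>_step: "\<And>k j. j \<le> k \<Longrightarrow> F j ((\<mu> k + 1) / 2) \<prec> F (Suc k) (\<mu> (Suc k))"
    by blast
  have \<mu>_mono: "\<mu> i \<le> \<mu> j" if "i \<le> j" for i j
    using \<mu>(3) that by (simp add: lift_Suc_mono_le less_imp_le)
  define K :: "rat \<Rightarrow> nat" where "K l = nat \<lfloor>1 / (1 - l)\<rfloor> - 1" for l
  define \<nu> where "\<nu> l = \<mu> (K l) + frac (1 / (1 - l)) * ((1 - \<mu> (K l)) / 2)" for l
  define H where "H l = F (K l) (\<nu> l)" for l
  have \<nu>: "\<mu> (K l) \<le> \<nu> l" "\<nu> l < (\<mu> (K l) + 1) / 2" for l
  proof -
    have "0 < (1 - \<mu> (K l)) / 2" using \<mu>(1)[of "K l"] by (simp add: I\<^sub>Q_def)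
    then have "0 \<le> frac (1 / (1 - l)) * ((1 - \<mu> (K l)) / 2)"
      "frac (1 / (1 - l)) * ((1 - \<mu> (K l)) / 2) < 1 * ((1 - \<mu> (K l)) / 2)"
      by (auto simp: frac_lt_1 intro!: mult_strict_right_mono)
    then show "\<mu> (K l) \<le> \<nu> l" "\<nu> l < (\<mu> (K l) + 1) / 2"
      unfolding \<nu>_def by (simp_all add: field_simps)
  qed
  have \<nu>I: "\<nu> l \<in> I\<^sub>Q" for l
    using \<nu>[of l] \<mu>(1)[of "K l"] by (auto simp: I\<^sub>Q_def)
  have H_less: "H l' \<prec> H l" if l: "l' \<in> I\<^sub>Q" "l \<in> I\<^sub>Q" "l' < l" for l' l
  proof -
    have lt: "1 / (1 - l') < 1 / (1 - l)"
      using l by (auto simp: I\<^sub>Q_def field_simps)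
    have ge1: "1 \<le> 1 / (1 - l')" "1 \<le> 1 / (1 - l)" using l by (auto simp: I\<^sub>Q_def field_simps)
    then have fl1: "1 \<le> \<lfloor>1 / (1 - l')\<rfloor>" "1 \<le> \<lfloor>1 / (1 - l)\<rfloor>" by simp_all
    have fl: "\<lfloor>1 / (1 - l')\<rfloor> \<le> \<lfloor>1 / (1 - l)\<rfloor>" using lt by (simp add: floor_mono)
    show ?thesis
    proof (cases "K l' = K l")
      case True
      then have "\<lfloor>1 / (1 - l')\<rfloor> = \<lfloor>1 / (1 - l)\<rfloor>" using fl fl1 unfolding K_def by linarith
      then have "frac (1 / (1 - l')) < frac (1 / (1 - l))" using lt by (simp add: frac_def)
      moreover have "0 < (1 - \<mu> (K l)) / 2" using \<mu>(1)[of "K l"] by (simp add: I\<^sub>Q_def)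
      ultimately have "\<nu> l' < \<nu> l" unfolding \<nu>_def True
        using mult_strict_right_mono by auto
      then show ?thesis unfolding H_def True using F \<nu>I cu_pathD(2) by blast
    next
      case False
      then have "K l' < K l" using fl fl1 unfolding K_def by linarith
      then obtain k where k: "K l = Suc k" "K l' \<le> k" by (metis Suc_diff_1 gr0I less_Suc_eq_le not_less0)
      have "\<nu> l' < (\<mu> k + 1) / 2" using \<nu>(2)[of l'] \<mu>_mono[OF k(2)] by simp
      then have "F (K l') (\<nu> l') \<prec> F (K l') ((\<mu> k + 1) / 2)"
        using F \<nu>I \<mu>(1) mid(1) cu_pathD(2) by blast
      then have *: "F (K l') (\<nu> l') \<prec> F (K l) (\<mu> (K l))"
        using \<mu>_step[OF k(2)] k(1) morph_below_trans by metis
      show ?thesis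
      proof (cases "\<mu> (K l) = \<nu> l")
        case True then show ?thesis using * by (simp add: H_def)
      next
        case False
        then have "F (K l) (\<mu> (K l)) \<prec> F (K l) (\<nu> l)"
          using \<nu>(1)[of l] F \<nu>I \<mu>(1) cu_pathD(2) by (metis order_le_less)
        then show ?thesis using * morph_below_trans unfolding H_def by blast
      qed
    qed
  qed
  have path: "cu_path H"
    unfolding cu_path_def using H_less cu_pathD(1)[OF F \<nu>I] by (auto simp: H_def)
  have upper: "F k \<lesssim> H" for k
    unfolding path_le_def
  proof
    fix l assume l: "l \<in> I\<^sub>Q"
    obtain n0 :: nat where n0: "1 / (1 - l) < of_nat n0" using reals_Archimedean2 by blast
    define n where "n = max k n0"
    have n: "k \<le> n" "1 / (1 - l) < of_nat n"
      using n0 by (auto simp: n_def intro: order_less_le_trans)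
    have "l < r n" unfolding r_def using IQ_less_cut[OF l n(2)] .
    then have "l < (\<mu> n + 1) / 2" using \<mu>(2)[of n] mid(2)[OF \<mu>(1)[of n]] by linarith
    then have 1: "F k l \<prec> F (Suc n) (\<mu> (Suc n))"
      using \<mu>_step[OF n(1)] F l \<mu>(1) mid(1) cu_pathD(2) morph_below_trans by blast
    define t :: rat where "t = 1 - 1 / (of_nat n + 2)"
    have t1: "1 / (1 - t) = of_nat (n + 2)" by (simp add: t_def)
    have Kt: "K t = Suc n" unfolding K_def t1 floor_of_nat by simp
    have "frac (1 / (1 - t)) = 0" unfolding t1 by (simp only: frac_def floor_of_nat of_int_of_nat_eq)
    then have "\<nu> t = \<mu> (Suc n)" unfolding \<nu>_def Kt by simp
    then have "F k l \<prec> H t" using 1 Kt by (simp add: H_def)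
    moreover have "t \<in> I\<^sub>Q" using r[of n] by (simp add: t_def r_def)
    ultimately show "\<exists>m\<in>I\<^sub>Q. F k l \<prec> H m" by blast
  qed
  have "\<exists>k. \<exists>m\<in>I\<^sub>Q. H l = F k m" for l using \<nu>I H_def by blast
  then show thesis using that path upper by blast
qed

lemma ihom_sup_path:
  fixes X :: "nat \<Rightarrow> ('a::cu_semigroup, 'b::cu_semigroup) ihom"
  assumes "incseq X" "\<And>k. cu_path (F k)" "\<And>k. X k = abs_ihom (F k)"
  obtains H where "cu_path H" "is_sup (range X) (abs_ihom H)"
    "\<And>l. l \<in> I\<^sub>Q \<Longrightarrow> \<exists>k. \<exists>m\<in>I\<^sub>Q. H l = F k m"
proof -
  have "F k \<lesssim> F (Suc k)" for k
    using assms(1) incseq_SucD[of X k] assms(2,3) ihom_le by metis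
  then obtain H where H: "cu_path H" "\<And>k. F k \<lesssim> H" "\<And>l. l \<in> I\<^sub>Q \<Longrightarrow> \<exists>k. \<exists>m\<in>I\<^sub>Q. H l = F k m"
    using sup_path[of F] assms(2) by blast
  have "is_sup (range X) (abs_ihom H)"
  proof (rule is_supI)
    show "x \<le> abs_ihom H" if "x \<in> range X" for x
      using that H ihom_le[OF assms(2) H(1)] assms(3) by auto
    show "abs_ihom H \<le> u" if u: "\<And>x. x \<in> range X \<Longrightarrow> x \<le> u" for u
    proof -
      obtain g where g: "cu_path g" "u = abs_ihom g" by (rule ihom_cases)
      have "F k \<lesssim> g" for k using u[of "X k"] assms g ihom_le by auto
      then have "H \<lesssim> g" using H(3) unfolding path_le_def by metis
      then show ?thesis using g H ihom_le by blast
    qed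
  qed
  then show thesis using H that by blast
qed

lemma ihom_way_belowI:
  assumes "cu_path f" "cu_path g" "m \<in> I\<^sub>Q" "\<And>l. l \<in> I\<^sub>Q \<Longrightarrow> f l \<prec> g m"
  shows "abs_ihom f \<lless> abs_ihom g"
  unfolding way_below_def
proof (intro allI impI)
  fix c :: "nat \<Rightarrow> ('a, 'b) ihom" and s
  assume c: "incseq c" "is_sup (range c) s" "abs_ihom g \<le> s"
  have "\<exists>f. cu_path f \<and> c k = abs_ihom f" for k using ihom_cases by metis
  then obtain F where F: "\<And>k. cu_path (F k)" "\<And>k. c k = abs_ihom (F k)" by metis
  obtain H where H: "cu_path H" "is_sup (range c) (abs_ihom H)"
    "\<And>l. l \<in> I\<^sub>Q \<Longrightarrow> \<exists>k. \<exists>m\<in>I\<^sub>Q. H l = F k m"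
    using ihom_sup_path[OF c(1) F] by blast
  have "abs_ihom g \<le> abs_ihom H" using c(2,3) H(2) is_sup_unique by metis
  then have "g \<lesssim> H" using assms H ihom_le by blast
  then obtain n where "n \<in> I\<^sub>Q" "g m \<prec> H n" using assms unfolding path_le_def by blast
  then obtain k n' where "n' \<in> I\<^sub>Q" "g m \<prec> F k n'" using H(3) by metis
  then have "f \<lesssim> F k" using assms unfolding path_le_def by (meson morph_below_trans)
  then show "\<exists>k. abs_ihom f \<le> c k" using F assms ihom_le by metis
qed

lemma IQ_mult: "s \<in> I\<^sub>Q \<Longrightarrow> l \<in> I\<^sub>Q \<Longrightarrow> s * l \<in> I\<^sub>Q \<and> s * l < s"
  by (auto simp: I\<^sub>Q_def mult_less_cancel_left1 intro: mult_strict_mono[of s 1 l 1, simplified])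

lemma cu_path_cut:
  assumes "cu_path f" "s \<in> I\<^sub>Q" shows "cu_path (\<lambda>l. f (s * l))"
  using assms cu_pathD[OF assms(1)] IQ_mult[OF assms(2)]
  by (auto simp: cu_path_def I\<^sub>Q_def)

definition cut_point :: "nat \<Rightarrow> rat" where
  "cut_point n = 1 - 1 / (of_nat n + 2)"

text \<open>Cutting a path off at rational parameters increasing to \<open>1\<close> exhibits its class as the
  supremum of a rapidly increasing sequence.\<close>

lemma ihom_cut:
  assumes f: "cu_path f"
  shows "\<And>n. cut_point n \<in> I\<^sub>Q" "\<And>n. cu_path (\<lambda>l. f (cut_point n * l))"
    "\<And>n. abs_ihom (\<lambda>l. f (cut_point n * l)) \<lless> abs_ihom (\<lambda>l. f (cut_point (Suc n) * l))"
    "is_sup (range (\<lambda>n. abs_ihom (\<lambda>l. f (cut_point n * l)))) (abs_ihom f)"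
proof -
  show s: "cut_point n \<in> I\<^sub>Q" for n by (auto simp: cut_point_def I\<^sub>Q_def field_simps)
  show p: "cu_path (\<lambda>l. f (cut_point n * l))" for n using cu_path_cut[OF f s] .
  have s_less: "cut_point n < cut_point (Suc n)" for n by (simp add: cut_point_def field_simps)
  show "abs_ihom (\<lambda>l. f (cut_point n * l)) \<lless> abs_ihom (\<lambda>l. f (cut_point (Suc n) * l))" for n
  proof (rule ihom_way_belowI[OF p p, where m = "cut_point n / cut_point (Suc n)"])
    show "cut_point n / cut_point (Suc n) \<in> I\<^sub>Q" using s[of n] s[of "Suc n"] s_less[of n] by (auto simp: I\<^sub>Q_def)
    show "f (cut_point n * l) \<prec> f (cut_point (Suc n) * (cut_point n / cut_point (Suc n)))" if "l \<in> I\<^sub>Q" for l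
      using cu_pathD(2)[OF f, of "cut_point n * l" "cut_point n"] IQ_mult[OF s that] s[of "Suc n"] s[of n]
      by (simp add: I\<^sub>Q_def)
  qed
  show "is_sup (range (\<lambda>n. abs_ihom (\<lambda>l. f (cut_point n * l)))) (abs_ihom f)"
  proof (rule is_supI)
    show "x \<le> abs_ihom f" if x: "x \<in> range (\<lambda>n. abs_ihom (\<lambda>l. f (cut_point n * l)))" for x
    proof -
      obtain n where n: "x = abs_ihom (\<lambda>l. f (cut_point n * l))" using x by blast
      have "(\<lambda>l. f (cut_point n * l)) \<lesssim> f"
        unfolding path_le_def using cu_pathD(2)[OF f] IQ_mult[OF s] s by blast
      then show ?thesis using n p f ihom_le by blast
    qed
    show "abs_ihom f \<le> u" if u: "\<And>x. x \<in> range (\<lambda>n. abs_ihom (\<lambda>l. f (cut_point n * l))) \<Longrightarrow> x \<le> u" for u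
    proof -
      obtain g where g: "cu_path g" "u = abs_ihom g" by (rule ihom_cases)
      have le: "(\<lambda>l. f (cut_point n * l)) \<lesssim> g" for n using u g p ihom_le by blast
      have "\<exists>m\<in>I\<^sub>Q. f l \<prec> g m" if l: "l \<in> I\<^sub>Q" for l
      proof -
        obtain n :: nat where n: "1 / (1 - l) < of_nat n" using reals_Archimedean2 by blast
        have "l < cut_point n" unfolding cut_point_def using IQ_less_cut[OF l n] .
        then have "l / cut_point n \<in> I\<^sub>Q" using l s[of n] by (auto simp: I\<^sub>Q_def)
        then obtain m where "m \<in> I\<^sub>Q" "f (cut_point n * (l / cut_point n)) \<prec> g m"
          using le[of n] unfolding path_le_def by blast
        then show ?thesis using s[of n] by (auto simp: I\<^sub>Q_def)
      qed
      then show ?thesis using g f ihom_le path_le_def by blast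
    qed
  qed
qed

lemma ihom_way_belowD:
  assumes "cu_path f" "cu_path g" "abs_ihom f \<lless> abs_ihom g"
  obtains m where "m \<in> I\<^sub>Q" "\<And>l. l \<in> I\<^sub>Q \<Longrightarrow> f l \<prec> g m"
proof -
  note cut = ihom_cut[OF assms(2)]
  have "incseq (\<lambda>n. abs_ihom (\<lambda>l. g (cut_point n * l)))"
    using cut(3) way_below_le by (intro incseq_SucI) blast
  then obtain n where "abs_ihom f \<le> abs_ihom (\<lambda>l. g (cut_point n * l))"
    using way_belowD[OF assms(3) _ cut(4)] by blast
  then have le: "f \<lesssim> (\<lambda>l. g (cut_point n * l))" using assms(1) cut(2) ihom_le by blast
  have "f l \<prec> g (cut_point n)" if "l \<in> I\<^sub>Q" for l
  proof -
    obtain m where "m \<in> I\<^sub>Q" "f l \<prec> g (cut_point n * m)" using le \<open>l \<in> I\<^sub>Q\<close> unfolding path_le_def by blast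
    then show ?thesis using cu_pathD(2)[OF assms(2)] IQ_mult cut(1) morph_below_trans by blast
  qed
  then show thesis using that cut(1) by blast
qed

instance ihom :: (cu_semigroup, cu_semigroup) cu_semigroup
proof
  fix c d :: "nat \<Rightarrow> ('a, 'b) ihom" and a a' b b' s t :: "('a, 'b) ihom"
  have ex: "\<exists>F. \<forall>k. cu_path (F k) \<and> c k = abs_ihom (F k)" for c :: "nat \<Rightarrow> ('a, 'b) ihom"
    by (rule choice) (meson ihom_cases)
  show "\<exists>s. is_sup (range c) s" if "incseq c"
    using ex[of c] ihom_sup_path[OF that] by metis
  show "\<exists>c. (\<forall>n. c n \<lless> c (Suc n)) \<and> is_sup (range c) a"
  proof -
    obtain f where f: "cu_path f" "a = abs_ihom f" by (rule ihom_cases)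
    show ?thesis unfolding f(2)
      by (rule exI, intro conjI allI) (rule ihom_cut(3)[OF f(1)], rule ihom_cut(4)[OF f(1)])
  qed
  show "a' + b' \<lless> a + b" if ab: "a' \<lless> a" "b' \<lless> b"
  proof -
    obtain f' f g' g where f: "cu_path f'" "a' = abs_ihom f'" "cu_path f" "a = abs_ihom f"
      "cu_path g'" "b' = abs_ihom g'" "cu_path g" "b = abs_ihom g"
      by (metis ihom_cases)
    obtain m where m: "m \<in> I\<^sub>Q" "\<And>l. l \<in> I\<^sub>Q \<Longrightarrow> f' l \<prec> f m"
      using ihom_way_belowD[of f' f] f ab by blast
    obtain n where n: "n \<in> I\<^sub>Q" "\<And>l. l \<in> I\<^sub>Q \<Longrightarrow> g' l \<prec> g n"
      using ihom_way_belowD[of g' g] f ab by blast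
    obtain k where k: "k \<in> I\<^sub>Q" "max m n < k" using IQ_above[of "max m n"] m n by (metis max_def)
    have "f' l \<prec> f k" "g' l \<prec> g k" if "l \<in> I\<^sub>Q" for l
      using k m n f that by (metis cu_pathD(2) max_less_iff_conj morph_below_trans)+
    then show ?thesis
      using f k(1) by (simp add: ihom_add cu_path_add ihom_way_belowI morph_below_add)
  qed
  show "is_sup (range (\<lambda>n. c n + d n)) (s + t)"
    if c: "incseq c" "incseq d" "is_sup (range c) s" "is_sup (range d) t"
  proof (rule is_supI)
    show "x \<le> s + t" if "x \<in> range (\<lambda>n. c n + d n)" for x
      using that is_sup_upper[OF c(3)] is_sup_upper[OF c(4)] by (auto intro!: add_mono)
    fix u assume u: "\<And>x. x \<in> range (\<lambda>n. c n + d n) \<Longrightarrow> x \<le> u"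
    obtain F where F: "\<And>k. cu_path (F k)" "\<And>k. c k = abs_ihom (F k)" using ex by metis
    obtain G where G: "\<And>k. cu_path (G k)" "\<And>k. d k = abs_ihom (G k)" using ex by metis
    obtain H where H: "cu_path H" "is_sup (range c) (abs_ihom H)"
      "\<And>l. l \<in> I\<^sub>Q \<Longrightarrow> \<exists>k. \<exists>m\<in>I\<^sub>Q. H l = F k m"
      using ihom_sup_path[OF c(1) F] by blast
    obtain K where K: "cu_path K" "is_sup (range d) (abs_ihom K)"
      "\<And>l. l \<in> I\<^sub>Q \<Longrightarrow> \<exists>k. \<exists>m\<in>I\<^sub>Q. K l = G k m"
      using ihom_sup_path[OF c(2) G] by blast
    obtain h where h: "cu_path h" "u = abs_ihom h" by (rule ihom_cases)
    have FG: "(\<lambda>l a. F k l a + G k l a) \<lesssim> h" for k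
      using u[of "c k + d k"] F G h by (simp add: ihom_add ihom_le cu_path_add)
    have "\<exists>m\<in>I\<^sub>Q. (\<lambda>a. H l a + K l a) \<prec> h m" if l: "l \<in> I\<^sub>Q" for l
    proof -
      obtain i m j n where mn: "m \<in> I\<^sub>Q" "H l = F i m" "n \<in> I\<^sub>Q" "K l = G j n"
        using H(3)[OF l] K(3)[OF l] by metis
      define k where "k = max i j"
      have "c i \<le> c k" "d j \<le> d k" using c(1,2) by (auto simp: k_def incseq_def)
      then have "F i \<lesssim> F k" "G j \<lesssim> G k" using F G ihom_le by metis+
      then obtain m' n' where mn': "m' \<in> I\<^sub>Q" "F i m \<prec> F k m'" "n' \<in> I\<^sub>Q" "G j n \<prec> G k n'"
        using mn unfolding path_le_def by metis
      obtain p where p: "p \<in> I\<^sub>Q" "max m' n' < p"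
        using IQ_above[of "max m' n'"] mn' by (metis max_def)
      have "F i m \<prec> F k p" "G j n \<prec> G k p"
        using mn' p F G by (metis cu_pathD(2) max_less_iff_conj morph_below_trans)+
      then have "(\<lambda>a. H l a + K l a) \<prec> (\<lambda>a. F k p a + G k p a)"
        using mn morph_below_add by metis
      then show ?thesis using FG[of k] p(1) unfolding path_le_def by (meson morph_below_trans)
    qed
    then have "abs_ihom H + abs_ihom K \<le> abs_ihom h"
      using H K h by (simp add: ihom_add ihom_le cu_path_add path_le_def)
    then show "s + t \<le> u" using c(3,4) H(2) K(2) h is_sup_unique by metis
  qed
qed


section \<open>The tensor product\<close>

text \<open>The tensor product is constructed as the Cu-completion of the algebraic tensor product of
  positively ordered semigroups. Formal finite sums of elementary tensors are finite multisets of
  pairs; \<open>tensor_le\<close> is the preorder on them whose associated quotient is the algebraic tensor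
  product, and \<open>tensor_below\<close> is the auxiliary relation that the way-below relations of the two
  factors induce on it. Points of the completion are the rounded ideals for this auxiliary relation
  that have a countable cofinal subset. The universal property is established below.\<close>

inductive tensor_le ::
    "('a::cu_semigroup \<times> 'b::cu_semigroup) multiset \<Rightarrow> ('a \<times> 'b) multiset \<Rightarrow> bool"
    (infix "\<preceq>" 50) where
  formal_refl: "x \<preceq> x"
| formal_trans: "x \<preceq> y \<Longrightarrow> y \<preceq> z \<Longrightarrow> x \<preceq> z"
| formal_add: "x \<preceq> y \<Longrightarrow> x + z \<preceq> y + z"
| formal_mono: "a \<le> a' \<Longrightarrow> b \<le> b' \<Longrightarrow> {#(a, b)#} \<preceq> {#(a', b')#}"
| formal_split_left: "{#(a + a', b)#} \<preceq> {#(a, b), (a', b)#}"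
| formal_join_left: "{#(a, b), (a', b)#} \<preceq> {#(a + a', b)#}"
| formal_split_right: "{#(a, b + b')#} \<preceq> {#(a, b), (a, b')#}"
| formal_join_right: "{#(a, b), (a, b')#} \<preceq> {#(a, b + b')#}"
| formal_zero_left: "{#(0, b)#} \<preceq> {#}"
| formal_zero_right: "{#(a, 0)#} \<preceq> {#}"
| formal_zero_least: "{#} \<preceq> {#(a, b)#}"

definition tensor_below ::
    "('a::cu_semigroup \<times> 'b::cu_semigroup) multiset \<Rightarrow> ('a \<times> 'b) multiset \<Rightarrow> bool" where
  "tensor_below x y \<longleftrightarrow>
     (\<exists>u v. x \<preceq> u \<and> rel_mset (\<lambda>(a', b') (a, b). a' \<lless> a \<and> b' \<lless> b) u v \<and> v \<preceq> y)"

definition tensor_ideal :: "('a::cu_semigroup \<times> 'b::cu_semigroup) multiset set \<Rightarrow> bool" where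
  "tensor_ideal I \<longleftrightarrow>
     {#} \<in> I \<and> (\<forall>x y. x \<preceq> y \<longrightarrow> y \<in> I \<longrightarrow> x \<in> I) \<and>
     (\<forall>x\<in>I. \<forall>y\<in>I. \<exists>z\<in>I. tensor_below x z \<and> tensor_below y z) \<and>
     (\<exists>C. countable C \<and> C \<subseteq> I \<and> (\<forall>x\<in>I. \<exists>c\<in>C. x \<preceq> c))"

definition approx_ms ::
    "('a::cu_semigroup \<times> 'b::cu_semigroup) multiset \<Rightarrow> nat \<Rightarrow> ('a \<times> 'b) multiset" where
  "approx_ms x n = image_mset (\<lambda>(a, b). (approx_seq a n, approx_seq b n)) x"

lemma tensor_le_add2: "x \<preceq> x' \<Longrightarrow> y \<preceq> y' \<Longrightarrow> x + y \<preceq> x' + y'"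
  by (metis formal_add formal_trans add.commute)

lemma tensor_le_empty: "{#} \<preceq> x"
proof (induction x)
  case empty
  then show ?case by (rule formal_refl)
next
  case (add p x)
  obtain a b where "p = (a, b)" by (cases p)
  then show ?case using tensor_le_add2[OF formal_zero_least[of a b] add] by simp
qed

lemma approx_ms_simps [simp]:
  "approx_ms {#} n = {#}" "approx_ms (x + y) n = approx_ms x n + approx_ms y n"
  "approx_ms (add_mset p x) n = add_mset (approx_seq (fst p) n, approx_seq (snd p) n) (approx_ms x n)"
  by (auto simp: approx_ms_def case_prod_beta)

lemma rel_mset_le: "rel_mset (\<lambda>(a', b') (a, b). a' \<le> a \<and> b' \<le> b) u v \<Longrightarrow> u \<preceq> v"
proof (induction v arbitrary: u)
  case empty
  then show ?case by (simp add: formal_refl)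
next
  case (add q v)
  then obtain p u' where u: "u = add_mset p u'" "case p of (a', b') \<Rightarrow> case q of (a, b) \<Rightarrow> a' \<le> a \<and> b' \<le> b"
    "rel_mset (\<lambda>(a', b') (a, b). a' \<le> a \<and> b' \<le> b) u' v"
    by (blast dest: msed_rel_invR)
  then have "{#p#} \<preceq> {#q#}" by (auto intro: formal_mono)
  then show ?case using tensor_le_add2[OF _ add.IH[OF u(3)]] u(1) by fastforce
qed

lemma approx_ms_step:
  "rel_mset (\<lambda>(a', b') (a, b). a' \<lless> a \<and> b' \<lless> b) (approx_ms x n) (approx_ms x (Suc n))"
  by (induction x) (auto intro!: rel_mset_Plus simp: approx_seq_step)

lemma approx_ms_below: "rel_mset (\<lambda>(a', b') (a, b). a' \<lless> a \<and> b' \<lless> b) (approx_ms x n) x"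
  by (induction x) (auto intro!: rel_mset_Plus simp: approx_seq_below)

lemma approx_ms_mono: assumes "m \<le> n" shows "approx_ms x m \<preceq> approx_ms x n"
  by (rule rel_mset_le, induction x) (auto intro!: rel_mset_Plus incseqD[OF approx_seq_incseq] assms)

lemma approx_ms_le: "approx_ms x n \<preceq> x"
  by (rule rel_mset_le, rule multiset.rel_mono_strong[OF approx_ms_below]) (auto dest: way_below_le)

lemma rel_mset_approx:
  "rel_mset (\<lambda>(a', b') (a, b). a' \<lless> a \<and> b' \<lless> b) u v \<Longrightarrow> \<exists>n. u \<preceq> approx_ms v n"
proof (induction v arbitrary: u)
  case empty
  then show ?case using formal_refl by auto
next
  case (add q v u0)
  then obtain p u where u: "u0 = add_mset p u" "case p of (a', b') \<Rightarrow> case q of (a, b) \<Rightarrow> a' \<lless> a \<and> b' \<lless> b"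
    "rel_mset (\<lambda>(a', b') (a, b). a' \<lless> a \<and> b' \<lless> b) u v"
    by (blast dest: msed_rel_invR)
  obtain a' b' a b where pq: "p = (a', b')" "q = (a, b)" by (cases p, cases q)
  obtain k where k: "u \<preceq> approx_ms v k" using add.IH[OF u(3)] by blast
  obtain i j where "a' \<le> approx_seq a i" "b' \<le> approx_seq b j"
    using u(2) pq way_below_approx by (metis case_prod_conv)
  note ijk = this k
  define n where "n = max i (max j k)"
  have "a' \<le> approx_seq a n" "b' \<le> approx_seq b n"
    using ijk approx_seq_incseq[of a] approx_seq_incseq[of b]
    by (auto simp: n_def incseq_def intro: order_trans)
  moreover have "u \<preceq> approx_ms v n"
    using ijk(3) approx_ms_mono[of k n v] by (auto simp: n_def intro: formal_trans)
  ultimately have "{#p#} + u \<preceq> {#(approx_seq a n, approx_seq b n)#} + approx_ms v n"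
    unfolding pq by (intro tensor_le_add2 formal_mono)
  then show ?case using pq u(1) by auto
qed

lemma approx_seq_le: "a \<le> b \<Longrightarrow> \<exists>m. approx_seq a n \<le> approx_seq b m"
  by (meson approx_seq_below order_refl way_below_approx way_below_mono)

lemma approx_seq_add: "\<exists>m. approx_seq (a + b) n \<le> approx_seq a m + approx_seq b m"
proof -
  have "is_sup (range (\<lambda>m. approx_seq a m + approx_seq b m)) (a + b)"
    using O4 approx_seq_incseq approx_seq_sup by blast
  moreover have "incseq (\<lambda>m. approx_seq a m + approx_seq b m)"
    using approx_seq_incseq[of a] approx_seq_incseq[of b] by (auto simp: incseq_def intro: add_mono)
  ultimately show ?thesis using way_belowD[OF approx_seq_below] by blast
qed

lemma approx_seq_add': "\<exists>m. approx_seq a n + approx_seq b n \<le> approx_seq (a + b) m"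
  using O3 approx_seq_below way_below_approx by blast

lemma tensor_le_approx: "x \<preceq> y \<Longrightarrow> \<exists>m. approx_ms x n \<preceq> approx_ms y m"
proof (induction arbitrary: n rule: tensor_le.induct)
  case (formal_refl x)
  show ?case using tensor_le.formal_refl by blast
next
  case (formal_trans x y z)
  then show ?case by (meson tensor_le.formal_trans)
next
  case (formal_add x y z)
  then obtain m where "approx_ms x n \<preceq> approx_ms y m" by blast
  then have "approx_ms x n \<preceq> approx_ms y (max n m)"
    using approx_ms_mono[of m "max n m"] tensor_le.formal_trans by auto
  then show ?case
    using tensor_le_add2[OF _ approx_ms_mono[of n "max n m"]] by fastforce
next
  case (formal_mono a a' b b')
  obtain i j where "approx_seq a n \<le> approx_seq a' i" "approx_seq b n \<le> approx_seq b' j"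
    using formal_mono approx_seq_le by metis
  then have "approx_seq a n \<le> approx_seq a' (max i j)" "approx_seq b n \<le> approx_seq b' (max i j)"
    using approx_seq_incseq[of a'] approx_seq_incseq[of b']
    by (auto simp: incseq_def intro: order_trans)
  then show ?case using tensor_le.formal_mono by fastforce
next
  case (formal_split_left a a' b)
  obtain i where i: "approx_seq (a + a') n \<le> approx_seq a i + approx_seq a' i"
    using approx_seq_add by blast
  define m where "m = max n i"
  have "approx_seq a i \<le> approx_seq a m" "approx_seq a' i \<le> approx_seq a' m"
    "approx_seq b n \<le> approx_seq b m"
    using approx_seq_incseq[of a] approx_seq_incseq[of a'] approx_seq_incseq[of b]
    by (auto simp: incseq_def m_def)
  then have "{#(approx_seq (a + a') n, approx_seq b n)#} \<preceq> {#(approx_seq a m + approx_seq a' m, approx_seq b m)#}"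
    using i by (intro tensor_le.formal_mono) (auto intro: order_trans add_mono)
  then show ?case using tensor_le.formal_split_left tensor_le.formal_trans by fastforce
next
  case (formal_join_left a b a')
  obtain i where i: "approx_seq a n + approx_seq a' n \<le> approx_seq (a + a') i"
    using approx_seq_add' by blast
  define m where "m = max n i"
  have "approx_seq (a + a') i \<le> approx_seq (a + a') m" "approx_seq b n \<le> approx_seq b m"
    using approx_seq_incseq[of "a + a'"] approx_seq_incseq[of b] by (auto simp: incseq_def m_def)
  then have "{#(approx_seq a n + approx_seq a' n, approx_seq b n)#} \<preceq> {#(approx_seq (a + a') m, approx_seq b m)#}"
    using i by (intro tensor_le.formal_mono) (auto intro: order_trans)
  then show ?case using tensor_le.formal_join_left tensor_le.formal_trans by fastforce
next
  case (formal_split_right a b b')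
  obtain i where i: "approx_seq (b + b') n \<le> approx_seq b i + approx_seq b' i"
    using approx_seq_add by blast
  define m where "m = max n i"
  have "approx_seq b i \<le> approx_seq b m" "approx_seq b' i \<le> approx_seq b' m"
    "approx_seq a n \<le> approx_seq a m"
    using approx_seq_incseq[of b] approx_seq_incseq[of b'] approx_seq_incseq[of a]
    by (auto simp: incseq_def m_def)
  then have "{#(approx_seq a n, approx_seq (b + b') n)#} \<preceq> {#(approx_seq a m, approx_seq b m + approx_seq b' m)#}"
    using i by (intro tensor_le.formal_mono) (auto intro: order_trans add_mono)
  then show ?case using tensor_le.formal_split_right tensor_le.formal_trans by fastforce
next
  case (formal_join_right a b b')
  obtain i where i: "approx_seq b n + approx_seq b' n \<le> approx_seq (b + b') i"
    using approx_seq_add' by blast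
  define m where "m = max n i"
  have "approx_seq (b + b') i \<le> approx_seq (b + b') m" "approx_seq a n \<le> approx_seq a m"
    using approx_seq_incseq[of "b + b'"] approx_seq_incseq[of a] by (auto simp: incseq_def m_def)
  then have "{#(approx_seq a n, approx_seq b n + approx_seq b' n)#} \<preceq> {#(approx_seq a m, approx_seq (b + b') m)#}"
    using i by (intro tensor_le.formal_mono) (auto intro: order_trans)
  then show ?case using tensor_le.formal_join_right tensor_le.formal_trans by fastforce
next
  case (formal_zero_left b)
  have "approx_seq (0::'a) n = 0" using approx_seq_below le_zero way_below_le by blast
  then show ?case using tensor_le.formal_zero_left by auto
next
  case (formal_zero_right a)
  have "approx_seq (0::'b) n = 0" using approx_seq_below le_zero way_below_le by blast
  then show ?case using tensor_le.formal_zero_right by auto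
next
  case (formal_zero_least a b)
  show ?case using tensor_le_empty by auto
qed

lemma tensor_below_iff: "tensor_below x y \<longleftrightarrow> (\<exists>n. x \<preceq> approx_ms y n)"
proof
  assume "tensor_below x y"
  then obtain u v where uv: "x \<preceq> u" "rel_mset (\<lambda>(a', b') (a, b). a' \<lless> a \<and> b' \<lless> b) u v" "v \<preceq> y"
    unfolding tensor_below_def by blast
  then obtain n where "u \<preceq> approx_ms v n" using rel_mset_approx by blast
  then show "\<exists>n. x \<preceq> approx_ms y n" using tensor_le_approx[OF uv(3)] uv(1) formal_trans by meson
next
  assume "\<exists>n. x \<preceq> approx_ms y n"
  then show "tensor_below x y"
    unfolding tensor_below_def using approx_ms_below formal_refl by blast
qed

lemma tensor_below_le: "tensor_below x y \<Longrightarrow> x \<preceq> y"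
  using approx_ms_le tensor_below_iff formal_trans by blast

lemma tensor_below_mono: "x \<preceq> x' \<Longrightarrow> tensor_below x' y' \<Longrightarrow> y' \<preceq> y \<Longrightarrow> tensor_below x y"
  unfolding tensor_below_def by (meson formal_trans)

lemma tensor_below_add: "tensor_below x x' \<Longrightarrow> tensor_below y y' \<Longrightarrow> tensor_below (x + y) (x' + y')"
proof -
  assume "tensor_below x x'" "tensor_below y y'"
  then obtain m n where mn: "x \<preceq> approx_ms x' m" "y \<preceq> approx_ms y' n" by (auto simp: tensor_below_iff)
  then have "x \<preceq> approx_ms x' (max m n)" "y \<preceq> approx_ms y' (max m n)"
    using approx_ms_mono formal_trans by (meson max.cobounded1 max.cobounded2)+
  then have "x + y \<preceq> approx_ms (x' + y') (max m n)" by (simp add: tensor_le_add2)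
  then show ?thesis unfolding tensor_below_iff by blast
qed

lemma tensor_below_approx_step: "tensor_below (approx_ms x n) (approx_ms x (Suc n))"
  unfolding tensor_below_def using approx_ms_step formal_refl by blast

lemma tensor_idealD:
  assumes "tensor_ideal I"
  shows "{#} \<in> I" "x \<preceq> y \<Longrightarrow> y \<in> I \<Longrightarrow> x \<in> I"
    "x \<in> I \<Longrightarrow> y \<in> I \<Longrightarrow> \<exists>z\<in>I. tensor_below x z \<and> tensor_below y z"
    "\<exists>C. countable C \<and> C \<subseteq> I \<and> (\<forall>x\<in>I. \<exists>c\<in>C. x \<preceq> c)"
  using assms unfolding tensor_ideal_def by blast+

lemma tensor_ideal_principal: "tensor_ideal {z. tensor_below z x}"
  unfolding tensor_ideal_def
proof (intro conjI allI impI ballI)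
  show "{#} \<in> {z. tensor_below z x}" by (auto simp: tensor_below_iff tensor_le_empty)
  show "u \<in> {z. tensor_below z x}" if "u \<preceq> v" "v \<in> {z. tensor_below z x}" for u v
    using that tensor_below_mono formal_refl by blast
  show "\<exists>w\<in>{z. tensor_below z x}. tensor_below u w \<and> tensor_below v w"
    if uv: "u \<in> {z. tensor_below z x}" "v \<in> {z. tensor_below z x}" for u v
  proof -
    obtain m n where "u \<preceq> approx_ms x m" "v \<preceq> approx_ms x n" using uv by (auto simp: tensor_below_iff)
    then have "u \<preceq> approx_ms x (max m n)" "v \<preceq> approx_ms x (max m n)"
      using approx_ms_mono formal_trans by (meson max.cobounded1 max.cobounded2)+
    then have "tensor_below u (approx_ms x (Suc (max m n)))" "tensor_below v (approx_ms x (Suc (max m n)))"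
      using tensor_below_approx_step tensor_below_mono formal_refl by blast+
    then show ?thesis using tensor_below_iff formal_refl by blast
  qed
  show "\<exists>C. countable C \<and> C \<subseteq> {z. tensor_below z x} \<and> (\<forall>u\<in>{z. tensor_below z x}. \<exists>c\<in>C. u \<preceq> c)"
    by (rule exI[of _ "range (approx_ms x)"]) (auto simp: tensor_below_iff intro: formal_refl)
qed

typedef (overloaded) ('a, 'b) tensor =
    "{I :: ('a::cu_semigroup \<times> 'b::cu_semigroup) multiset set. tensor_ideal I}"
  morphisms ideal_of Abs_tensor
  using tensor_ideal_principal by blast

setup_lifting type_definition_tensor

lemma tensor_ideal_sum:
  assumes I: "tensor_ideal I" and J: "tensor_ideal J"
  shows "tensor_ideal {z. \<exists>x\<in>I. \<exists>y\<in>J. z \<preceq> x + y}" (is "tensor_ideal ?K")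
  unfolding tensor_ideal_def
proof (intro conjI allI impI ballI)
  show "{#} \<in> ?K" using tensor_idealD(1)[OF I] tensor_idealD(1)[OF J] tensor_le_empty by blast
  show "u \<in> ?K" if "u \<preceq> v" "v \<in> ?K" for u v using that formal_trans by blast
  show "\<exists>w\<in>?K. tensor_below u w \<and> tensor_below v w" if uv: "u \<in> ?K" "v \<in> ?K" for u v
  proof -
    obtain x y x' y' where xy: "x \<in> I" "y \<in> J" "u \<preceq> x + y" "x' \<in> I" "y' \<in> J" "v \<preceq> x' + y'"
      using uv by blast
    obtain p where p: "p \<in> I" "tensor_below x p" "tensor_below x' p" using tensor_idealD(3)[OF I] xy by blast
    obtain q where q: "q \<in> J" "tensor_below y q" "tensor_below y' q" using tensor_idealD(3)[OF J] xy by blast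
    have "tensor_below u (p + q)" "tensor_below v (p + q)"
      using tensor_below_mono tensor_below_add formal_refl p q xy by blast+
    then show ?thesis using p q formal_refl by blast
  qed
  obtain C where C: "countable C" "C \<subseteq> I" "\<forall>x\<in>I. \<exists>c\<in>C. x \<preceq> c" using tensor_idealD(4)[OF I] by blast
  obtain D where D: "countable D" "D \<subseteq> J" "\<forall>x\<in>J. \<exists>c\<in>D. x \<preceq> c" using tensor_idealD(4)[OF J] by blast
  show "\<exists>C. countable C \<and> C \<subseteq> ?K \<and> (\<forall>u\<in>?K. \<exists>c\<in>C. u \<preceq> c)"
  proof (intro exI[of _ "(\<lambda>(x, y). x + y) ` (C \<times> D)"] conjI)
    show "countable ((\<lambda>(x, y). x + y) ` (C \<times> D))" using C D by blast
    show "(\<lambda>(x, y). x + y) ` (C \<times> D) \<subseteq> ?K" using C D formal_refl by fastforce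
    show "\<forall>u\<in>?K. \<exists>c\<in>(\<lambda>(x, y). x + y) ` (C \<times> D). u \<preceq> c"
    proof
      fix u assume "u \<in> ?K"
      then obtain x y where "x \<in> I" "y \<in> J" "u \<preceq> x + y" by blast
      moreover from this obtain c d where "c \<in> C" "x \<preceq> c" "d \<in> D" "y \<preceq> d" using C D by blast
      ultimately show "\<exists>c\<in>(\<lambda>(x, y). x + y) ` (C \<times> D). u \<preceq> c"
        using tensor_le_add2 formal_trans by (intro bexI[of _ "c + d"]) blast+
    qed
  qed
qed

instantiation tensor :: (cu_semigroup, cu_semigroup) positively_ordered_semigroup
begin

lift_definition less_eq_tensor :: "('a, 'b) tensor \<Rightarrow> ('a, 'b) tensor \<Rightarrow> bool" is "(\<subseteq>)" .

lift_definition less_tensor :: "('a, 'b) tensor \<Rightarrow> ('a, 'b) tensor \<Rightarrow> bool" is "(\<subset>)" .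

lift_definition zero_tensor :: "('a, 'b) tensor" is "{z. tensor_below z {#}}"
  by (rule tensor_ideal_principal)

lift_definition plus_tensor :: "('a, 'b) tensor \<Rightarrow> ('a, 'b) tensor \<Rightarrow> ('a, 'b) tensor"
  is "\<lambda>I J. {z. \<exists>x\<in>I. \<exists>y\<in>J. z \<preceq> x + y}"
  by (rule tensor_ideal_sum)

instance
proof
  fix x y z :: "('a, 'b) tensor"
  show "(x < y) = (x \<le> y \<and> \<not> y \<le> x)" by transfer blast
  show "x \<le> x" by transfer blast
  show "x \<le> z" if "x \<le> y" "y \<le> z" using that by transfer blast
  show "x = y" if "x \<le> y" "y \<le> x" using that by transfer blast
  show "x + y = y + x" by transfer (metis (no_types, lifting) add.commute)
  show "z + x \<le> z + y" if "x \<le> y" using that by transfer blast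
  show "x + y + z = x + (y + z)"
  proof (transfer, intro set_eqI iffI CollectI)
    fix I J K :: "('a \<times> 'b) multiset set" and u
    assume "u \<in> {u. \<exists>x\<in>{u. \<exists>x\<in>I. \<exists>y\<in>J. u \<preceq> x + y}. \<exists>y\<in>K. u \<preceq> x + y}"
    then obtain p x y z where "x \<in> I" "y \<in> J" "p \<preceq> x + y" "z \<in> K" "u \<preceq> p + z" by blast
    moreover from this have "u \<preceq> x + (y + z)"
      by (metis add.assoc formal_add formal_trans)
    ultimately show "\<exists>x\<in>I. \<exists>y\<in>{u. \<exists>x\<in>J. \<exists>y\<in>K. u \<preceq> x + y}. u \<preceq> x + y"
      using formal_refl by blast
  next
    fix I J K :: "('a \<times> 'b) multiset set" and u
    assume "u \<in> {u. \<exists>x\<in>I. \<exists>y\<in>{u. \<exists>x\<in>J. \<exists>y\<in>K. u \<preceq> x + y}. u \<preceq> x + y}"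
    then obtain p x y z where "x \<in> I" "y \<in> J" "p \<preceq> y + z" "z \<in> K" "u \<preceq> x + p" by blast
    moreover from this have "u \<preceq> x + y + z"
      by (metis add.assoc tensor_le_add2 formal_refl formal_trans)
    ultimately show "\<exists>x\<in>{u. \<exists>x\<in>I. \<exists>y\<in>J. u \<preceq> x + y}. \<exists>y\<in>K. u \<preceq> x + y"
      using formal_refl by blast
  qed
  show "0 + x = x"
  proof (transfer, intro set_eqI iffI CollectI)
    fix I :: "('a \<times> 'b) multiset set" and u
    assume I: "tensor_ideal I"
    assume "u \<in> {z. \<exists>x\<in>{z. tensor_below z {#}}. \<exists>y\<in>I. z \<preceq> x + y}"
    then obtain p y where "tensor_below p {#}" "y \<in> I" "u \<preceq> p + y" by blast
    moreover from this have "u \<preceq> y"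
      by (metis add_0 tensor_below_le formal_add formal_trans)
    ultimately show "u \<in> I" using tensor_idealD(2)[OF I] by blast
  next
    fix I :: "('a \<times> 'b) multiset set" and u
    assume "tensor_ideal I" "u \<in> I"
    then show "\<exists>x\<in>{z. tensor_below z {#}}. \<exists>y\<in>I. u \<preceq> x + y"
      by (auto simp: tensor_below_iff intro!: bexI[of _ u] exI[of _ "{#}"] formal_refl)
  qed
  show "0 \<le> x"
  proof transfer
    fix I :: "('a \<times> 'b) multiset set"
    assume "tensor_ideal I"
    then show "{z. tensor_below z {#}} \<subseteq> I" using tensor_below_le tensor_idealD(1,2) by blast
  qed
qed

end


subsection \<open>The tensor product is a Cu-semigroup\<close>

lift_definition tensor_of :: "('a::cu_semigroup \<times> 'b::cu_semigroup) multiset \<Rightarrow> ('a, 'b) tensor"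
  is "\<lambda>x. {z. tensor_below z x}"
  by (rule tensor_ideal_principal)

definition tensor_pair :: "'a::cu_semigroup \<Rightarrow> 'b::cu_semigroup \<Rightarrow> ('a, 'b) tensor"
    (infixl "\<otimes>" 70) where
  "a \<otimes> b = tensor_of {#(a, b)#}"

lemma ideal_of_ideal: "tensor_ideal (ideal_of I)"
  using ideal_of by blast

lemma tensor_sup:
  fixes X :: "nat \<Rightarrow> ('a::cu_semigroup, 'b::cu_semigroup) tensor"
  assumes X: "incseq X"
  shows "\<exists>s. ideal_of s = (\<Union>k. ideal_of (X k)) \<and> is_sup (range X) s"
proof -
  have mono: "ideal_of (X i) \<subseteq> ideal_of (X j)" if "i \<le> j" for i j
    using X that by (simp add: incseq_def less_eq_tensor.rep_eq)
  have "tensor_ideal (\<Union>k. ideal_of (X k))"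
    unfolding tensor_ideal_def
  proof (intro conjI allI impI ballI)
    show "{#} \<in> (\<Union>k. ideal_of (X k))" using tensor_idealD(1)[OF ideal_of_ideal] by blast
    show "x \<in> (\<Union>k. ideal_of (X k))" if "x \<preceq> y" "y \<in> (\<Union>k. ideal_of (X k))" for x y
      using that tensor_idealD(2)[OF ideal_of_ideal] by blast
    show "\<exists>z\<in>\<Union>k. ideal_of (X k). tensor_below x z \<and> tensor_below y z"
      if xy: "x \<in> (\<Union>k. ideal_of (X k))" "y \<in> (\<Union>k. ideal_of (X k))" for x y
    proof -
      obtain i j where "x \<in> ideal_of (X i)" "y \<in> ideal_of (X j)" using xy by blast
      then have "x \<in> ideal_of (X (max i j))" "y \<in> ideal_of (X (max i j))"
        using mono[of i "max i j"] mono[of j "max i j"] by auto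
      then show ?thesis using tensor_idealD(3)[OF ideal_of_ideal] by blast
    qed
    have "\<exists>C. \<forall>k. countable (C k) \<and> C k \<subseteq> ideal_of (X k) \<and> (\<forall>x\<in>ideal_of (X k). \<exists>c\<in>C k. x \<preceq> c)"
      by (rule choice) (use tensor_idealD(4)[OF ideal_of_ideal] in blast)
    then obtain C where C: "\<And>k. countable (C k)" "\<And>k. C k \<subseteq> ideal_of (X k)"
      "\<And>k. \<forall>x\<in>ideal_of (X k). \<exists>c\<in>C k. x \<preceq> c" by metis
    show "\<exists>C. countable C \<and> C \<subseteq> (\<Union>k. ideal_of (X k)) \<and>
        (\<forall>x\<in>\<Union>k. ideal_of (X k). \<exists>c\<in>C. x \<preceq> c)"
    proof (intro exI[of _ "\<Union>k. C k"] conjI)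
      show "countable (\<Union>k. C k)" using C(1) by blast
      show "(\<Union>k. C k) \<subseteq> (\<Union>k. ideal_of (X k))" using C(2) by blast
      show "\<forall>x\<in>\<Union>k. ideal_of (X k). \<exists>c\<in>\<Union>k. C k. x \<preceq> c" using C(3) by blast
    qed
  qed
  then have id: "ideal_of (Abs_tensor (\<Union>k. ideal_of (X k))) = (\<Union>k. ideal_of (X k))"
    by (simp add: Abs_tensor_inverse)
  have "is_sup (range X) (Abs_tensor (\<Union>k. ideal_of (X k)))"
    by (rule is_supI) (auto simp: less_eq_tensor.rep_eq id)
  then show ?thesis using id by blast
qed

lemma tensor_is_sup_iff:
  fixes X :: "nat \<Rightarrow> ('a::cu_semigroup, 'b::cu_semigroup) tensor"
  assumes X: "incseq X"
  shows "is_sup (range X) s \<longleftrightarrow> ideal_of s = (\<Union>k. ideal_of (X k))"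
  using tensor_sup[OF X] by (metis ideal_of_inject is_sup_unique)

lemma tensor_ideal_sequence:
  assumes I: "tensor_ideal I"
  shows "\<exists>x. (\<forall>n. x n \<in> I) \<and> (\<forall>n. tensor_below (x n) (x (Suc n))) \<and>
    (\<forall>u\<in>I. \<exists>n. tensor_below u (x n))"
proof -
  obtain C where C: "countable C" "C \<subseteq> I" "\<forall>x\<in>I. \<exists>c\<in>C. x \<preceq> c"
    using tensor_idealD(4)[OF I] by blast
  then have "C \<noteq> {}" using tensor_idealD(1)[OF I] by blast
  then obtain c :: "nat \<Rightarrow> _" where c: "C = range c" using C(1) uncountable_def by blast
  have cI: "c n \<in> I" for n using c C(2) by blast
  have "\<exists>x. \<forall>n. x n \<in> I \<and> (tensor_below (x n) (x (Suc n)) \<and> tensor_below (c n) (x (Suc n)))"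
  proof (rule dependent_nat_choice)
    show "\<exists>x. x \<in> I" using tensor_idealD(1)[OF I] by blast
    show "\<exists>y. y \<in> I \<and> (tensor_below x y \<and> tensor_below (c n) y)" if "x \<in> I" for x n
      using tensor_idealD(3)[OF I that cI] by blast
  qed
  then obtain x where x: "\<And>n. x n \<in> I" "\<And>n. tensor_below (x n) (x (Suc n))"
    "\<And>n. tensor_below (c n) (x (Suc n))" by blast
  have "\<exists>n. tensor_below u (x n)" if "u \<in> I" for u
  proof -
    obtain n where "u \<preceq> c n" using C(3) c \<open>u \<in> I\<close> by blast
    then show ?thesis using x(3) tensor_below_mono formal_refl by blast
  qed
  then show ?thesis using x(1,2) by blast
qed

lemma tensor_way_belowI:
  assumes "y \<in> ideal_of J" "\<And>u. u \<in> ideal_of I \<Longrightarrow> u \<preceq> y"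
  shows "I \<lless> J"
  unfolding way_below_def
proof (intro allI impI)
  fix c :: "nat \<Rightarrow> ('a, 'b) tensor" and s
  assume c: "incseq c" "is_sup (range c) s" "J \<le> s"
  then obtain k where "y \<in> ideal_of (c k)"
    using assms(1) by (auto simp: tensor_is_sup_iff less_eq_tensor.rep_eq)
  then have "I \<le> c k"
    unfolding less_eq_tensor.rep_eq using assms(2) tensor_idealD(2)[OF ideal_of_ideal] by blast
  then show "\<exists>k. I \<le> c k" ..
qed

lemma tensor_of_mem: "u \<in> ideal_of (tensor_of x) \<longleftrightarrow> tensor_below u x"
  by (simp add: tensor_of.rep_eq)

lemma tensor_of_le: "tensor_of x \<le> I" if "x \<in> ideal_of I"
  unfolding less_eq_tensor.rep_eq subset_iff tensor_of_mem
  using that tensor_idealD(2)[OF ideal_of_ideal[of I]] tensor_below_le by blast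

lemma tensor_of_mono: "x \<preceq> y \<Longrightarrow> tensor_of x \<le> tensor_of y"
  unfolding less_eq_tensor.rep_eq subset_iff tensor_of_mem
  using tensor_below_mono formal_refl by blast

lemma tensor_of_way_below: "tensor_below x y \<Longrightarrow> tensor_of x \<lless> tensor_of y"
  by (rule tensor_way_belowI[of x]) (auto simp: tensor_of_mem tensor_below_le)

lemma tensor_as_sup:
  "\<exists>x. (\<forall>n. x n \<in> ideal_of I) \<and> (\<forall>n. tensor_below (x n) (x (Suc n))) \<and>
    incseq (\<lambda>n. tensor_of (x n)) \<and> is_sup (range (\<lambda>n. tensor_of (x n))) I"
proof -
  obtain x where x: "\<And>n. x n \<in> ideal_of I" "\<And>n. tensor_below (x n) (x (Suc n))"
    "\<And>u. u \<in> ideal_of I \<Longrightarrow> \<exists>n. tensor_below u (x n)"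
    using tensor_ideal_sequence[OF ideal_of_ideal] by metis
  have inc: "incseq (\<lambda>n. tensor_of (x n))"
    using x(2) by (intro incseq_SucI way_below_le tensor_of_way_below)
  have "ideal_of I = (\<Union>n. ideal_of (tensor_of (x n)))"
    unfolding set_eq_iff UN_iff tensor_of_mem
    using x(1,3) tensor_idealD(2)[OF ideal_of_ideal[of I]] tensor_below_le by blast
  then have "is_sup (range (\<lambda>n. tensor_of (x n))) I" using tensor_is_sup_iff[OF inc] by blast
  then show ?thesis using x(1,2) inc by blast
qed

lemma tensor_way_belowD:
  assumes "I \<lless> J" obtains y where "y \<in> ideal_of J" "I \<le> tensor_of y"
proof -
  obtain x where "\<And>n. x n \<in> ideal_of J" "\<And>n. tensor_below (x n) (x (Suc n))"
    "incseq (\<lambda>n. tensor_of (x n))" "is_sup (range (\<lambda>n. tensor_of (x n))) J"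
    using tensor_as_sup[of J] by blast
  then show thesis using way_belowD[OF assms] that by blast
qed

instance tensor :: (cu_semigroup, cu_semigroup) cu_semigroup
proof
  fix c d :: "nat \<Rightarrow> ('a, 'b) tensor" and a a' b b' s t :: "('a, 'b) tensor"
  show "\<exists>s. is_sup (range c) s" if "incseq c" using tensor_sup[OF that] by blast
  show "\<exists>c. (\<forall>n. c n \<lless> c (Suc n)) \<and> is_sup (range c) a"
  proof -
    obtain x where "\<And>n. x n \<in> ideal_of a" "\<And>n. tensor_below (x n) (x (Suc n))"
      "incseq (\<lambda>n. tensor_of (x n))" "is_sup (range (\<lambda>n. tensor_of (x n))) a"
      using tensor_as_sup[of a] by blast
    then show ?thesis by (intro exI[of _ "\<lambda>n. tensor_of (x n)"]) (simp add: tensor_of_way_below)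
  qed
  show "a' + b' \<lless> a + b" if ab: "a' \<lless> a" "b' \<lless> b"
  proof -
    obtain x where x: "x \<in> ideal_of a" "a' \<le> tensor_of x" using tensor_way_belowD[OF ab(1)] by blast
    obtain y where y: "y \<in> ideal_of b" "b' \<le> tensor_of y" using tensor_way_belowD[OF ab(2)] by blast
    show ?thesis
    proof (rule tensor_way_belowI)
      show "x + y \<in> ideal_of (a + b)" using x y formal_refl by (auto simp: plus_tensor.rep_eq)
      show "u \<preceq> x + y" if u: "u \<in> ideal_of (a' + b')" for u
      proof -
        obtain p q where "p \<in> ideal_of a'" "q \<in> ideal_of b'" "u \<preceq> p + q"
          using u by (auto simp: plus_tensor.rep_eq)
        moreover from this have "p \<preceq> x" "q \<preceq> y"
          using x(2) y(2) tensor_below_le unfolding less_eq_tensor.rep_eq subset_iff tensor_of_mem by blast+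
        ultimately show ?thesis using tensor_le_add2 formal_trans by blast
      qed
    qed
  qed
  show "is_sup (range (\<lambda>n. c n + d n)) (s + t)"
    if c: "incseq c" "incseq d" "is_sup (range c) s" "is_sup (range d) t"
  proof -
    have inc: "incseq (\<lambda>n. c n + d n)" using c by (auto simp: incseq_def intro: add_mono)
    have st: "ideal_of s = (\<Union>k. ideal_of (c k))" "ideal_of t = (\<Union>k. ideal_of (d k))"
      using c tensor_is_sup_iff by blast+
    have mono: "ideal_of (c i) \<subseteq> ideal_of (c j)" "ideal_of (d i) \<subseteq> ideal_of (d j)" if "i \<le> j" for i j
      using c(1,2) that by (simp_all add: incseq_def less_eq_tensor.rep_eq)
    have "u \<in> (\<Union>k. ideal_of (c k + d k))" if u: "u \<in> ideal_of (s + t)" for u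
    proof -
      obtain x y i j where "x \<in> ideal_of (c i)" "y \<in> ideal_of (d j)" "u \<preceq> x + y"
        using u by (auto simp: plus_tensor.rep_eq st)
      moreover from this have "x \<in> ideal_of (c (max i j))" "y \<in> ideal_of (d (max i j))"
        using mono(1)[of i "max i j"] mono(2)[of j "max i j"] by auto
      ultimately show ?thesis by (auto simp: plus_tensor.rep_eq)
    qed
    moreover have "u \<in> ideal_of (s + t)" if "u \<in> (\<Union>k. ideal_of (c k + d k))" for u
      using that by (auto simp: plus_tensor.rep_eq st)
    ultimately have "ideal_of (s + t) = (\<Union>k. ideal_of (c k + d k))" by blast
    then show ?thesis using tensor_is_sup_iff[OF inc] by blast
  qed
qed


subsection \<open>The universal property\<close>

lemma tensor_of_add: "tensor_of (x + y) = tensor_of x + tensor_of y"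
proof -
  have "tensor_below u (x + y) \<longleftrightarrow> (\<exists>p q. tensor_below p x \<and> tensor_below q y \<and> u \<preceq> p + q)" for u
  proof
    assume "tensor_below u (x + y)"
    then obtain n where "u \<preceq> approx_ms x n + approx_ms y n" by (auto simp: tensor_below_iff)
    then show "\<exists>p q. tensor_below p x \<and> tensor_below q y \<and> u \<preceq> p + q"
      using tensor_below_iff formal_refl by blast
  next
    assume "\<exists>p q. tensor_below p x \<and> tensor_below q y \<and> u \<preceq> p + q"
    then show "tensor_below u (x + y)" using tensor_below_add tensor_below_mono formal_refl by blast
  qed
  then have "ideal_of (tensor_of (x + y)) = ideal_of (tensor_of x + tensor_of y)"
    by (auto simp: plus_tensor.rep_eq tensor_of.rep_eq)
  then show ?thesis by (simp add: ideal_of_inject)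
qed

lemma tensor_of_empty: "tensor_of {#} = 0"
  by transfer simp

lemma tensor_of_eqI: "x \<preceq> y \<Longrightarrow> y \<preceq> x \<Longrightarrow> tensor_of x = tensor_of y"
  by (simp add: antisym tensor_of_mono)

theorem cu_bimorphism_tensor: "cu_bimorphism ((\<otimes>) :: 'a::cu_semigroup \<Rightarrow> 'b::cu_semigroup \<Rightarrow> _)"
proof -
  have sup: "is_sup (range (\<lambda>k. c k \<otimes> d k)) (s \<otimes> t)"
    if c: "incseq c" "incseq d" "is_sup (range c) s" "is_sup (range d) t"
    for c :: "nat \<Rightarrow> 'a" and d :: "nat \<Rightarrow> 'b" and s t
  proof -
    have inc: "incseq (\<lambda>k. c k \<otimes> d k)"
      using c(1,2) unfolding tensor_pair_def incseq_def by (auto intro!: tensor_of_mono formal_mono)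
    have le: "{#(c k, d k)#} \<preceq> {#(s, t)#}" for k
      using c(3,4) by (intro formal_mono) (auto intro: is_sup_upper)
    have "\<exists>k. tensor_below u {#(c k, d k)#}" if u: "tensor_below u {#(s, t)#}" for u
    proof -
      obtain n where n: "u \<preceq> {#(approx_seq s n, approx_seq t n)#}" using u by (auto simp: tensor_below_iff)
      obtain i j where "approx_seq s (Suc n) \<le> c i" "approx_seq t (Suc n) \<le> d j"
        using way_belowD[OF approx_seq_below c(1,3)] way_belowD[OF approx_seq_below c(2,4)] by blast
      moreover have "c i \<le> c (max i j)" "d j \<le> d (max i j)"
        using c(1,2) by (auto simp: incseq_def)
      ultimately have "approx_seq s n \<lless> c (max i j)" "approx_seq t n \<lless> d (max i j)"
        using approx_seq_step way_below_mono order_trans by blast+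
      then have "rel_mset (\<lambda>(a', b') (a, b). a' \<lless> a \<and> b' \<lless> b)
          {#(approx_seq s n, approx_seq t n)#} {#(c (max i j), d (max i j))#}"
        by (auto intro!: rel_mset_Plus)
      then show ?thesis unfolding tensor_below_def using n formal_refl by blast
    qed
    then have "ideal_of (s \<otimes> t) = (\<Union>k. ideal_of (c k \<otimes> d k))"
      unfolding tensor_pair_def set_eq_iff UN_iff tensor_of_mem
      using tensor_below_mono[OF formal_refl _ le] by blast
    then show ?thesis using tensor_is_sup_iff[OF inc] by blast
  qed
  have wb: "a' \<otimes> b' \<lless> a \<otimes> b" if "a' \<lless> a" "b' \<lless> b" for a' a :: 'a and b' b :: 'b
  proof -
    have "rel_mset (\<lambda>(a', b') (a, b). a' \<lless> a \<and> b' \<lless> b) {#(a', b')#} {#(a, b)#}"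
      using that by (auto intro!: rel_mset_Plus)
    then have "tensor_below {#(a', b')#} {#(a, b)#}"
      unfolding tensor_below_def using formal_refl by blast
    then show ?thesis unfolding tensor_pair_def by (rule tensor_of_way_below)
  qed
  have add: "(a + a') \<otimes> b = a \<otimes> b + a' \<otimes> b" "a \<otimes> (b + b') = a \<otimes> b + a \<otimes> b'"
    for a a' :: 'a and b b' :: 'b
    unfolding tensor_pair_def tensor_of_add[symmetric]
    using tensor_of_eqI[OF formal_split_left formal_join_left, of a a' b]
      tensor_of_eqI[OF formal_split_right formal_join_right, of a b b'] by (simp_all add: add_mset_commute)
  have zero: "0 \<otimes> b = 0" "a \<otimes> 0 = 0" for a :: 'a and b :: 'b
    unfolding tensor_pair_def tensor_of_empty[symmetric]
    by (intro tensor_of_eqI formal_zero_left formal_zero_right formal_zero_least)+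
  have mono: "a \<otimes> b \<le> a' \<otimes> b'" if "a \<le> a'" "b \<le> b'" for a a' :: 'a and b b' :: 'b
    unfolding tensor_pair_def using that by (intro tensor_of_mono formal_mono)
  have mono': "mono (\<lambda>a::'a. a \<otimes> b)" "mono (\<lambda>b::'b. a \<otimes> b)" for a :: 'a and b :: 'b
    by (auto intro!: monoI mono)
  show ?thesis
    unfolding cu_bimorphism_def gen_cu_bimorphism_def
    using sup wb add zero mono' by (intro conjI allI impI) simp_all
qed

theorem gen_cu_morphism_tensor_le:
  assumes f: "gen_cu_morphism f" and g: "gen_cu_morphism g"
    and le: "\<And>a b. f (a \<otimes> b) \<le> g (a \<otimes> b)"
  shows "f x \<le> g x"
proof -
  have *: "f (tensor_of u) \<le> g (tensor_of u)" for u
  proof (induction u)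
    case empty
    show ?case by (simp add: tensor_of_empty gen_cu_morphismD(2)[OF f] zero_least)
  next
    case (add p u)
    have "tensor_of (add_mset p u) = fst p \<otimes> snd p + tensor_of u"
      using tensor_of_add[of "{#p#}" u] by (simp add: tensor_pair_def)
    then show ?case
      using add le[of "fst p" "snd p"] gen_cu_morphismD(1)[OF f] gen_cu_morphismD(1)[OF g]
      by (simp add: add_mono)
  qed
  obtain u where u: "incseq (\<lambda>n. tensor_of (u n))" "is_sup (range (\<lambda>n. tensor_of (u n))) x"
    using tensor_as_sup[of x] by blast
  show ?thesis
  proof (rule is_sup_least[OF gen_cu_morphismD(4)[OF f u]])
    fix y assume "y \<in> range (\<lambda>n. f (tensor_of (u n)))"
    then obtain n where n: "y = f (tensor_of (u n))" by blast
    have "g (tensor_of (u n)) \<le> g x"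
      using is_sup_upper[OF gen_cu_morphismD(4)[OF g u]] by blast
    then show "y \<le> g x" using n *[of "u n"] by simp
  qed
qed

lemma gen_cu_morphism_tensor_eq:
  assumes "gen_cu_morphism f" "gen_cu_morphism g" "\<And>a b. f (a \<otimes> b) = g (a \<otimes> b)"
  shows "f = g"
proof
  show "f x = g x" for x
    using gen_cu_morphism_tensor_le[OF assms(1,2)] gen_cu_morphism_tensor_le[OF assms(2,1)]
    by (simp add: antisym assms(3))
qed

theorem gen_cu_bimorphism_lift:
  fixes \<phi> :: "'a::cu_semigroup \<Rightarrow> 'b::cu_semigroup \<Rightarrow> 'c::cu_semigroup"
  assumes \<phi>: "gen_cu_bimorphism \<phi>"
  shows "\<exists>!h. gen_cu_morphism h \<and> (\<forall>a b. h (a \<otimes> b) = \<phi> a b)"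
    and "cu_bimorphism \<phi> \<Longrightarrow> \<exists>!h. cu_morphism h \<and> (\<forall>a b. h (a \<otimes> b) = \<phi> a b)"
proof -
  define F where "F x = (\<Sum>(a, b)\<in>#x. \<phi> a b)" for x :: "('a \<times> 'b) multiset"
  have F_simps: "F {#} = 0" "F (x + y) = F x + F y" "F {#(a, b)#} = \<phi> a b"
    "F (add_mset p x) = \<phi> (fst p) (snd p) + F x" for x y a b p
    by (simp_all add: F_def case_prod_beta)
  have F_le: "F x \<le> F y" if "x \<preceq> y" for x y
    using that
  proof (induction rule: tensor_le.induct)
    case (formal_add x y z)
    then show ?case by (simp add: F_simps add_mono)
  next
    case (formal_mono a a' b b')
    then show ?case by (simp add: F_simps gen_cu_bimorphismD(5)[OF \<phi>])
  qed (auto simp: F_simps gen_cu_bimorphismD(1-4)[OF \<phi>] zero_least)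
  have F_approx_inc: "incseq (\<lambda>n. F (approx_ms x n))" for x
    unfolding incseq_def using F_le approx_ms_mono by blast
  have F_approx: "is_sup (range (\<lambda>n. F (approx_ms x n))) (F x)" for x
  proof (induction x)
    case empty
    show ?case by (auto simp: F_simps is_sup_iff)
  next
    case (add p x)
    have "is_sup (range (\<lambda>n. \<phi> (approx_seq (fst p) n) (approx_seq (snd p) n))) (\<phi> (fst p) (snd p))"
      by (intro gen_cu_bimorphismD(6)[OF \<phi>] approx_seq_incseq approx_seq_sup)
    moreover have "incseq (\<lambda>n. \<phi> (approx_seq (fst p) n) (approx_seq (snd p) n))"
      unfolding incseq_def
      by (auto intro!: gen_cu_bimorphismD(5)[OF \<phi>] incseqD[OF approx_seq_incseq])
    ultimately show ?case using O4[OF _ F_approx_inc _ add] by (simp add: F_simps)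
  qed
  define h where "h I = sup_of (F ` ideal_of I)" for I
  have h_seq: "is_sup (range (\<lambda>n. F (x n))) (h I)"
    if x: "\<And>n. x n \<in> ideal_of I" "\<And>n. tensor_below (x n) (x (Suc n))"
      "\<And>u. u \<in> ideal_of I \<Longrightarrow> \<exists>n. tensor_below u (x n)" for x I
  proof -
    have "incseq (\<lambda>n. F (x n))" using x(2) by (intro incseq_SucI F_le tensor_below_le)
    then obtain s where s: "is_sup (range (\<lambda>n. F (x n))) s" using O1 by blast
    have "is_sup (F ` ideal_of I) s"
    proof (rule is_sup_cofinal[OF s])
      show "\<exists>y\<in>F ` ideal_of I. z \<le> y" if "z \<in> range (\<lambda>n. F (x n))" for z using that x(1) by blast
      show "\<exists>z\<in>range (\<lambda>n. F (x n)). y \<le> z" if "y \<in> F ` ideal_of I" for y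
        using that x(3) F_le tensor_below_le by blast
    qed
    then show ?thesis using s sup_of_eq unfolding h_def by metis
  qed
  have h_sup: "is_sup (F ` ideal_of I) (h I)" for I
  proof -
    obtain x where x: "\<And>n. x n \<in> ideal_of I" "\<And>n. tensor_below (x n) (x (Suc n))"
      "\<And>u. u \<in> ideal_of I \<Longrightarrow> \<exists>n. tensor_below u (x n)"
      using tensor_ideal_sequence[OF ideal_of_ideal] by metis
    show ?thesis
    proof (rule is_sup_cofinal[OF h_seq[OF x]])
      show "\<exists>y\<in>F ` ideal_of I. z \<le> y" if "z \<in> range (\<lambda>n. F (x n))" for z using that x(1) by blast
      show "\<exists>z\<in>range (\<lambda>n. F (x n)). y \<le> z" if "y \<in> F ` ideal_of I" for y
        using that x(3) F_le tensor_below_le by blast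
    qed
  qed
  have h_of: "h (tensor_of x) = F x" for x
  proof (rule is_sup_unique[OF h_sup])
    show "is_sup (F ` ideal_of (tensor_of x)) (F x)"
    proof (rule is_sup_cofinal[OF F_approx])
      show "\<exists>z\<in>F ` ideal_of (tensor_of x). y \<le> z" if y: "y \<in> range (\<lambda>n. F (approx_ms x n))" for y
      proof -
        obtain n where n: "y = F (approx_ms x n)" using y by blast
        have "approx_ms x n \<in> ideal_of (tensor_of x)"
          using formal_refl by (auto simp: tensor_of_mem tensor_below_iff)
        then show ?thesis using n by blast
      qed
      show "\<exists>z\<in>range (\<lambda>n. F (approx_ms x n)). y \<le> z" if "y \<in> F ` ideal_of (tensor_of x)" for y
      proof -
        obtain u n where "y = F u" "u \<preceq> approx_ms x n"
          using \<open>y \<in> F ` ideal_of (tensor_of x)\<close> by (auto simp: tensor_of_mem tensor_below_iff)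
        then show ?thesis using F_le by blast
      qed
    qed
  qed
  have h_mono: "h I \<le> h J" if "I \<le> J" for I J
  proof (rule is_sup_least[OF h_sup])
    fix y assume "y \<in> F ` ideal_of I"
    then have "y \<in> F ` ideal_of J" using that by (auto simp: less_eq_tensor.rep_eq)
    then show "y \<le> h J" by (rule is_sup_upper[OF h_sup])
  qed
  have h_add: "h (I + J) = h I + h J" for I J
  proof -
    obtain x where x: "\<And>n. x n \<in> ideal_of I" "\<And>n. tensor_below (x n) (x (Suc n))"
      "\<And>u. u \<in> ideal_of I \<Longrightarrow> \<exists>n. tensor_below u (x n)"
      using tensor_ideal_sequence[OF ideal_of_ideal] by metis
    obtain y where y: "\<And>n. y n \<in> ideal_of J" "\<And>n. tensor_below (y n) (y (Suc n))"
      "\<And>u. u \<in> ideal_of J \<Longrightarrow> \<exists>n. tensor_below u (y n)"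
      using tensor_ideal_sequence[OF ideal_of_ideal] by metis
    have inc: "incseq (\<lambda>n. F (x n))" "incseq (\<lambda>n. F (y n))"
      using x(2) y(2) by (auto intro!: incseq_SucI F_le tensor_below_le)
    have xm: "x i \<preceq> x j" "y i \<preceq> y j" if "i \<le> j" for i j
      using that
    proof (induction j rule: dec_induct)
      case (step n)
      show "x i \<preceq> x (Suc n)" "y i \<preceq> y (Suc n)"
        using step.IH x(2)[of n] y(2)[of n] tensor_below_le formal_trans by blast+
    qed (rule formal_refl)+
    have 1: "is_sup (range (\<lambda>n. F (x n) + F (y n))) (h I + h J)"
      by (rule O4[OF inc h_seq[OF x] h_seq[OF y]])
    have "is_sup (F ` ideal_of (I + J)) (h I + h J)"
    proof (rule is_sup_cofinal[OF 1])
      show "\<exists>v\<in>F ` ideal_of (I + J). u \<le> v" if u: "u \<in> range (\<lambda>n. F (x n) + F (y n))" for u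
      proof -
        obtain n where n: "u = F (x n + y n)" using u by (auto simp: F_simps)
        have "x n + y n \<in> ideal_of (I + J)"
          unfolding plus_tensor.rep_eq mem_Collect_eq using x(1)[of n] y(1)[of n] formal_refl by blast
        then show ?thesis using n by blast
      qed
      show "\<exists>v\<in>range (\<lambda>n. F (x n) + F (y n)). u \<le> v" if u: "u \<in> F ` ideal_of (I + J)" for u
      proof -
        obtain w p q where w: "u = F w" "p \<in> ideal_of I" "q \<in> ideal_of J" "w \<preceq> p + q"
          using u by (auto simp: plus_tensor.rep_eq)
        obtain i j where "p \<preceq> x i" "q \<preceq> y j" using x(3) y(3) w tensor_below_le by blast
        then have "p \<preceq> x (max i j)" "q \<preceq> y (max i j)"
          using xm[of i "max i j"] xm[of j "max i j"] formal_trans by auto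
        then have "w \<preceq> x (max i j) + y (max i j)" using w tensor_le_add2 formal_trans by blast
        then have "u \<le> F (x (max i j)) + F (y (max i j))" using F_le w(1) F_simps(2) by metis
        then show ?thesis by blast
      qed
    qed
    then show ?thesis using h_sup is_sup_unique by blast
  qed
  have h_cont: "is_sup (range (\<lambda>n. h (c n))) (h s)" if c: "incseq c" "is_sup (range c) s" for c s
  proof (rule is_supI)
    show "y \<le> h s" if "y \<in> range (\<lambda>n. h (c n))" for y
      using that is_sup_upper[OF c(2)] h_mono by auto
    show "h s \<le> u" if u: "\<And>y. y \<in> range (\<lambda>n. h (c n)) \<Longrightarrow> y \<le> u" for u
    proof (rule is_sup_least[OF h_sup])
      fix y assume "y \<in> F ` ideal_of s"
      then obtain x where x: "y = F x" "x \<in> ideal_of s" by blast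
      moreover have "ideal_of s = (\<Union>k. ideal_of (c k))" using c tensor_is_sup_iff by blast
      ultimately obtain n where "x \<in> ideal_of (c n)" by blast
      then have "F x \<le> h (c n)" using is_sup_upper[OF h_sup] by blast
      then show "y \<le> u" using u[of "h (c n)"] x by auto
    qed
  qed
  have "h 0 = 0" using h_of[of "{#}"] by (simp add: tensor_of_empty F_simps)
  then have gen: "gen_cu_morphism h"
    unfolding gen_cu_morphism_def using h_add monoI[of h, OF h_mono] h_cont
    by (intro conjI allI impI) simp_all
  have h_pair: "h (a \<otimes> b) = \<phi> a b" for a b
    by (simp add: tensor_pair_def h_of F_simps)
  show "\<exists>!h. gen_cu_morphism h \<and> (\<forall>a b. h (a \<otimes> b) = \<phi> a b)"
  proof (rule ex1I[of _ h])
    show "h' = h" if "gen_cu_morphism h' \<and> (\<forall>a b. h' (a \<otimes> b) = \<phi> a b)" for h'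
      by (rule gen_cu_morphism_tensor_eq) (use that gen h_pair in auto)
  qed (use gen h_pair in auto)
  assume cu: "cu_bimorphism \<phi>"
  have F_rel: "rel_mset (\<lambda>(a', b') (a, b). a' \<lless> a \<and> b' \<lless> b) u v \<Longrightarrow> F u \<lless> F v" for u v
  proof (induction v arbitrary: u)
    case empty
    then have "u = {#}" by simp
    then show ?case by (simp add: F_simps zero_way_below)
  next
    case (add q v)
    then obtain p u' where u: "u = add_mset p u'"
      "case p of (a', b') \<Rightarrow> case q of (a, b) \<Rightarrow> a' \<lless> a \<and> b' \<lless> b"
      "rel_mset (\<lambda>(a', b') (a, b). a' \<lless> a \<and> b' \<lless> b) u' v"
      by (blast dest: msed_rel_invR)
    have "\<phi> (fst p) (snd p) \<lless> \<phi> (fst q) (snd q)"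
      using u(2) cu_bimorphismD(2)[OF cu] by (auto simp: case_prod_beta)
    then show ?case using O3 add.IH[OF u(3)] u(1) by (simp add: F_simps)
  qed
  have "h I \<lless> h J" if IJ: "I \<lless> J" for I J
  proof -
    obtain y where y: "y \<in> ideal_of J" "I \<le> tensor_of y" using tensor_way_belowD[OF IJ] .
    obtain z where z: "z \<in> ideal_of J" "tensor_below y z"
      using y(1) tensor_idealD(3)[OF ideal_of_ideal] by blast
    then obtain u v where "y \<preceq> u" "rel_mset (\<lambda>(a', b') (a, b). a' \<lless> a \<and> b' \<lless> b) u v" "v \<preceq> z"
      unfolding tensor_below_def by blast
    then have "F y \<lless> F z" using F_rel F_le way_below_mono by blast
    moreover have "h I \<le> F y" using h_mono[OF y(2)] by (simp add: h_of)
    moreover have "F z \<le> h J" using is_sup_upper[OF h_sup] z(1) by blast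
    ultimately show ?thesis using way_below_mono by blast
  qed
  then have "cu_morphism h" using gen by (auto simp: cu_morphism_def)
  then show "\<exists>!h. cu_morphism h \<and> (\<forall>a b. h (a \<otimes> b) = \<phi> a b)"
  proof (intro ex1I[of _ h])
    show "h' = h" if "cu_morphism h' \<and> (\<forall>a b. h' (a \<otimes> b) = \<phi> a b)" for h'
      by (rule gen_cu_morphism_tensor_eq) (use that gen h_pair cu_morphismD(1) in auto)
  qed (use h_pair in auto)
qed


section \<open>Evaluation and composition\<close>

text \<open>The class in the internal hom of the constant path at a Cu-morphism.\<close>

definition hom_class :: "('a::cu_semigroup \<Rightarrow> 'b::cu_semigroup) \<Rightarrow> ('a, 'b) ihom" where
  "hom_class \<phi> = abs_ihom (\<lambda>_. \<phi>)"

lift_definition endpoint :: "('a::cu_semigroup, 'b::cu_semigroup) ihom \<Rightarrow> 'a \<Rightarrow> 'b"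
  is "\<lambda>f a. sup_of ((\<lambda>l. f l a) ` I\<^sub>Q)"
proof
  fix f g :: "rat \<Rightarrow> 'a \<Rightarrow> 'b" and a
  assume "path_equiv f g"
  then have fg: "cu_path f" "cu_path g" "f \<lesssim> g" "g \<lesssim> f" by (auto simp: path_equiv_def)
  have le: "\<exists>y\<in>(\<lambda>l. g l a) ` I\<^sub>Q. x \<le> y"
    if "cu_path f" "cu_path g" "f \<lesssim> g" "x \<in> (\<lambda>l. f l a) ` I\<^sub>Q" for f g :: "rat \<Rightarrow> 'a \<Rightarrow> 'b" and x
    using that morph_below_le cu_pathD(1) unfolding path_le_def by blast
  have "is_sup ((\<lambda>l. f l a) ` I\<^sub>Q) s \<longleftrightarrow> is_sup ((\<lambda>l. g l a) ` I\<^sub>Q) s" for s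
    using is_sup_cofinal[of "(\<lambda>l. f l a) ` I\<^sub>Q" s "(\<lambda>l. g l a) ` I\<^sub>Q", OF _ le[OF fg(1,2,3)] le[OF fg(2,1,4)]]
      is_sup_cofinal[of "(\<lambda>l. g l a) ` I\<^sub>Q" s "(\<lambda>l. f l a) ` I\<^sub>Q", OF _ le[OF fg(2,1,4)] le[OF fg(1,2,3)]]
    by blast
  then show "sup_of ((\<lambda>l. f l a) ` I\<^sub>Q) = sup_of ((\<lambda>l. g l a) ` I\<^sub>Q)"
    by (simp add: sup_of_def)
qed

text \<open>For \<open>S = 's\<close>, \<open>T = 't\<close>, \<open>P = 'p\<close>, the map \<open>adjunct\<close> restricts to the bijection from the
  Cu-morphisms from \<open>S\<close> to the internal hom of \<open>T\<close> and \<open>P\<close> onto the Cu-morphisms from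
  \<open>S \<otimes> T\<close> to \<open>P\<close>.\<close>

definition adjunct ::
    "('s::cu_semigroup \<Rightarrow> ('t::cu_semigroup, 'p::cu_semigroup) ihom) \<Rightarrow> ('s, 't) tensor \<Rightarrow> 'p" where
  "adjunct \<alpha> = (THE \<beta>. cu_morphism \<beta> \<and> (\<forall>a b. \<beta> (a \<otimes> b) = endpoint (\<alpha> a) b))"

definition evaluation :: "(('s::cu_semigroup, 't::cu_semigroup) ihom, 's) tensor \<Rightarrow> 't" where
  "evaluation = adjunct id"

definition tensor_map ::
    "('a::cu_semigroup \<Rightarrow> 'c::cu_semigroup) \<Rightarrow> ('b::cu_semigroup \<Rightarrow> 'd::cu_semigroup)
      \<Rightarrow> ('a, 'b) tensor \<Rightarrow> ('c, 'd) tensor" where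
  "tensor_map \<alpha> \<beta> = (THE h. cu_morphism h \<and> (\<forall>a b. h (a \<otimes> b) = \<alpha> a \<otimes> \<beta> b))"

definition tensor_assoc ::
    "(('a::cu_semigroup, 'b::cu_semigroup) tensor, 'c::cu_semigroup) tensor
      \<Rightarrow> ('a, ('b, 'c) tensor) tensor" where
  "tensor_assoc = (THE h. cu_morphism h \<and> (\<forall>a b c. h (a \<otimes> b \<otimes> c) = a \<otimes> (b \<otimes> c)))"

definition composition ::
    "(('t::cu_semigroup, 'p::cu_semigroup) ihom, ('s::cu_semigroup, 't) ihom) tensor
      \<Rightarrow> ('s, 'p) ihom" where
  "composition = (THE \<gamma>. cu_morphism \<gamma> \<and>
     adjunct \<gamma> = evaluation \<circ> tensor_map id evaluation \<circ> tensor_assoc)"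


section \<open>Cu-semirings and their actions\<close>

locale cu_semiring =
  fixes mult :: "'r::cu_semigroup \<Rightarrow> 'r \<Rightarrow> 'r" and one :: 'r
  assumes bimorphism: "cu_bimorphism mult"
    and assoc: "mult (mult r s) t = mult r (mult s t)"
    and one_right: "mult r one = r"
    and one_left: "mult one r = r"

locale cu_left_action = cu_semiring mult one
  for mult :: "'r::cu_semigroup \<Rightarrow> 'r \<Rightarrow> 'r" and one :: 'r +
  fixes act :: "'r \<Rightarrow> 's::cu_semigroup \<Rightarrow> 's"
  assumes act_bimorphism: "cu_bimorphism act"
    and act_mult: "act (mult r1 r2) a = act r1 (act r2 a)"
    and act_one: "act one a = a"

end

theory Submission
  imports Defs
begin

text \<open>Composing paths levelwise gives a Cu-bimorphism on internal homs whose endpoint map is the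
  composition of endpoint maps. A Cu-morphism into an internal hom is determined by its endpoint
  maps, although a single element is not. Hence the composition product is induced by levelwise
  composition of paths, for which the axioms of a Cu-semiring and of a left action are immediate.\<close>

section \<open>The endpoint map\<close>

lemma cu_bimorphismI:
  assumes "\<And>a a' b. f (a + a') b = f a b + f a' b" "\<And>a b b'. f a (b + b') = f a b + f a b'"
    and "\<And>b. f 0 b = 0" "\<And>a. f a 0 = 0"
    and "\<And>a a' b b'. a \<le> a' \<Longrightarrow> b \<le> b' \<Longrightarrow> f a b \<le> f a' b'"
    and "\<And>c d s t. incseq c \<Longrightarrow> incseq d \<Longrightarrow> is_sup (range c) s \<Longrightarrow> is_sup (range d) t
      \<Longrightarrow> is_sup (range (\<lambda>k. f (c k) (d k))) (f s t)"
    and "\<And>a' a b' b. a' \<lless> a \<Longrightarrow> b' \<lless> b \<Longrightarrow> f a' b' \<lless> f a b"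
  shows "cu_bimorphism f"
  unfolding cu_bimorphism_def gen_cu_bimorphism_def
  using assms by (intro conjI allI impI monoI) simp_all

lemma ihom_seq_paths:
  obtains F where "\<And>k. cu_path (F k)" "\<And>k. c k = abs_ihom (F k)"
proof -
  have "\<exists>F. \<forall>k. cu_path (F k) \<and> c k = abs_ihom (F k)" by (rule choice) (meson ihom_cases)
  then show thesis using that by blast
qed

section \<open>Suprema of paths along cut points\<close>

lemma path_mono:
  assumes "cu_path f" "l \<in> I\<^sub>Q" "m \<in> I\<^sub>Q" "l \<le> m" shows "f l a \<le> f m a"
proof (cases "l = m")
  case False
  then have "f l \<prec> f m" using assms cu_pathD(2) by (metis order_le_less)
  then show ?thesis using morph_below_le cu_pathD(1) assms(1-3) by blast
qed simp

lemma cut_point_IQ: "cut_point n \<in> I\<^sub>Q"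
  by (auto simp: cut_point_def I\<^sub>Q_def field_simps)

lemma cut_point_incseq: "cu_path f \<Longrightarrow> incseq (\<lambda>n. f (cut_point n) a)"
  by (intro incseq_SucI path_mono cut_point_IQ) (auto simp: cut_point_def field_simps)

text \<open>The cut points increase to 1, so they are cofinal in \<open>I\<^sub>Q\<close>. This
  trades a supremum over the rationals for one over an increasing sequence, the only kind of
  supremum that O1 and O4 speak about.\<close>

lemma cut_point_sup_iff:
  assumes f: "cu_path f"
  shows "is_sup (range (\<lambda>n. f (cut_point n) a)) s \<longleftrightarrow> is_sup ((\<lambda>l. f l a) ` I\<^sub>Q) s"
proof -
  have 1: "\<exists>y\<in>(\<lambda>l. f l a) ` I\<^sub>Q. x \<le> y" if "x \<in> range (\<lambda>n. f (cut_point n) a)" for x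
    using that cut_point_IQ by blast
  have 2: "\<exists>x\<in>range (\<lambda>n. f (cut_point n) a). y \<le> x" if y: "y \<in> (\<lambda>l. f l a) ` I\<^sub>Q" for y
  proof -
    obtain l where l: "l \<in> I\<^sub>Q" "y = f l a" using y by blast
    obtain n :: nat where "1 / (1 - l) < of_nat n" using reals_Archimedean2 by blast
    then have "l < cut_point n" unfolding cut_point_def using IQ_less_cut[OF l(1)] by blast
    then show ?thesis using path_mono[OF f l(1) cut_point_IQ, of n] l(2) by auto
  qed
  show ?thesis by (rule iffI; erule is_sup_cofinal) (use 1 2 in blast)+
qed

text \<open>\<open>endpoint\<close> is built on the definite description \<open>sup_of\<close>,
  which says nothing until a supremum is known to exist. O1 along the cut points supplies
  it.\<close>

lemma endpoint_is_sup_cut: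
  assumes "cu_path f"
  shows "is_sup (range (\<lambda>n. f (cut_point n) a)) (endpoint (abs_ihom f) a)"
proof -
  obtain s where s: "is_sup (range (\<lambda>n. f (cut_point n) a)) s"
    using O1 cut_point_incseq[OF assms] by blast
  then have "sup_of ((\<lambda>l. f l a) ` I\<^sub>Q) = s"
    using sup_of_eq cut_point_sup_iff[OF assms] by blast
  then show ?thesis using s by (simp add: endpoint.abs_eq path_equiv_refl assms)
qed

lemma endpoint_is_sup: "cu_path f \<Longrightarrow> is_sup ((\<lambda>l. f l a) ` I\<^sub>Q) (endpoint (abs_ihom f) a)"
  using endpoint_is_sup_cut cut_point_sup_iff by blast

lemma endpoint_upper: "cu_path f \<Longrightarrow> l \<in> I\<^sub>Q \<Longrightarrow> f l a \<le> endpoint (abs_ihom f) a"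
  by (rule is_sup_upper[OF endpoint_is_sup]) auto

lemma endpoint_least:
  "cu_path f \<Longrightarrow> (\<And>l. l \<in> I\<^sub>Q \<Longrightarrow> f l a \<le> u) \<Longrightarrow> endpoint (abs_ihom f) a \<le> u"
  by (rule is_sup_least[OF endpoint_is_sup]) auto

section \<open>The endpoint map as a Cu-bimorphism\<close>

lemma endpoint_mono:
  assumes "x \<le> y" "a \<le> b" shows "endpoint x a \<le> endpoint y b"
proof -
  obtain f g where fg: "cu_path f" "x = abs_ihom f" "cu_path g" "y = abs_ihom g"
    by (metis ihom_cases)
  then have "f \<lesssim> g" using assms(1) ihom_le by blast
  show ?thesis unfolding fg
  proof (rule endpoint_least[OF fg(1)])
    fix l assume l: "l \<in> I\<^sub>Q"
    then obtain m where m: "m \<in> I\<^sub>Q" "f l \<prec> g m" using \<open>f \<lesssim> g\<close> unfolding path_le_def by blast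
    have "f l a \<le> f l b" using gen_cu_morphismD(3)[OF cu_pathD(1)[OF fg(1) l] assms(2)] .
    also have "\<dots> \<le> g m b" using morph_below_le cu_pathD(1) fg l m by blast
    also have "\<dots> \<le> endpoint (abs_ihom g) b" using endpoint_upper fg(3) m(1) .
    finally show "f l a \<le> endpoint (abs_ihom g) b" .
  qed
qed

text \<open>Both sides are the supremum of one sequence along the cut points: for the right side
  this is O4, for the left side the levelwise definition of addition.\<close>

lemma endpoint_add_left: "endpoint (x + y) a = endpoint x a + endpoint y a"
proof -
  obtain f g where fg: "cu_path f" "x = abs_ihom f" "cu_path g" "y = abs_ihom g"
    by (metis ihom_cases)
  have "is_sup (range (\<lambda>n. f (cut_point n) a + g (cut_point n) a)) (endpoint x a + endpoint y a)"
    unfolding fg by (intro O4 cut_point_incseq endpoint_is_sup_cut fg)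
  moreover have "is_sup (range (\<lambda>n. f (cut_point n) a + g (cut_point n) a)) (endpoint (x + y) a)"
    using endpoint_is_sup_cut[OF cu_path_add[OF fg(1,3)]] unfolding fg(2,4) ihom_add[OF fg(1,3)] .
  ultimately show ?thesis using is_sup_unique by blast
qed

lemma endpoint_add_right: "endpoint x (a + b) = endpoint x a + endpoint x b"
proof -
  obtain f where f: "cu_path f" "x = abs_ihom f" by (rule ihom_cases)
  have "is_sup (range (\<lambda>n. f (cut_point n) a + f (cut_point n) b)) (endpoint x a + endpoint x b)"
    unfolding f by (intro O4 cut_point_incseq endpoint_is_sup_cut f)
  moreover have "f (cut_point n) (a + b) = f (cut_point n) a + f (cut_point n) b" for n
    using gen_cu_morphismD(1)[OF cu_pathD(1)[OF f(1) cut_point_IQ]] .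
  ultimately show ?thesis
    using endpoint_is_sup_cut[OF f(1), of "a + b"] is_sup_unique f(2) by auto
qed

lemma endpoint_zero: "endpoint x 0 = 0" "endpoint 0 a = 0"
proof -
  obtain f where f: "cu_path f" "x = abs_ihom f" by (rule ihom_cases)
  show "endpoint x 0 = 0" unfolding f(2)
    by (rule le_zero, rule endpoint_least[OF f(1)])
      (simp add: gen_cu_morphismD(2)[OF cu_pathD(1)[OF f(1)]])
  show "endpoint 0 a = 0" unfolding zero_ihom_def
    by (rule le_zero, rule endpoint_least[OF cu_path_zero]) simp
qed

text \<open>The supremum of \<open>c\<close> has a representative \<open>H\<close> each of whose
  levels is a level of a single \<open>F k\<close>. A bound therefore has to be checked only for
  \<open>F k m\<close>, which preserves the supremum of \<open>d\<close>.\<close>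

lemma endpoint_sup:
  assumes c: "incseq c" "incseq d" "is_sup (range c) s" "is_sup (range d) t"
  shows "is_sup (range (\<lambda>k. endpoint (c k) (d k))) (endpoint s t)"
proof (rule is_supI)
  show "x \<le> endpoint s t" if "x \<in> range (\<lambda>k. endpoint (c k) (d k))" for x
    using that is_sup_upper[OF c(3)] is_sup_upper[OF c(4)] by (auto intro!: endpoint_mono)
  fix u assume u: "\<And>x. x \<in> range (\<lambda>k. endpoint (c k) (d k)) \<Longrightarrow> x \<le> u"
  obtain F where F: "\<And>k. cu_path (F k)" "\<And>k. c k = abs_ihom (F k)" using ihom_seq_paths[of c] by blast
  obtain H where H: "cu_path H" "is_sup (range c) (abs_ihom H)"
    "\<And>l. l \<in> I\<^sub>Q \<Longrightarrow> \<exists>k. \<exists>m\<in>I\<^sub>Q. H l = F k m"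
    using ihom_sup_path[OF c(1) F] by blast
  have "s = abs_ihom H" using c(3) H(2) by (rule is_sup_unique)
  moreover have "endpoint (abs_ihom H) t \<le> u"
  proof (rule endpoint_least[OF H(1)])
    fix l assume "l \<in> I\<^sub>Q"
    then obtain k m where k: "m \<in> I\<^sub>Q" "H l = F k m" using H(3) by blast
    have "is_sup (range (\<lambda>j. F k m (d j))) (F k m t)"
      using gen_cu_morphismD(4)[OF cu_pathD(1)[OF F(1) k(1)] c(2,4)] .
    then have "F k m t \<le> u"
    proof (rule is_sup_least)
      fix y assume "y \<in> range (\<lambda>j. F k m (d j))"
      then obtain j where "y = F k m (d j)" by blast
      then have "y \<le> endpoint (c k) (d j)" using endpoint_upper F k(1) by metis
      \<comment> \<open>The bound \<open>u\<close> is given only on the diagonal, so both indices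
        are raised to their maximum.\<close>
      also have "\<dots> \<le> endpoint (c (max k j)) (d (max k j))"
        by (intro endpoint_mono incseqD[OF c(1)] incseqD[OF c(2)]) auto
      also have "\<dots> \<le> u" using u by blast
      finally show "y \<le> u" .
    qed
    then show "H l t \<le> u" using k(2) by simp
  qed
  ultimately show "endpoint s t \<le> u" by simp
qed

lemma endpoint_way_below:
  assumes "x' \<lless> x" "a' \<lless> a" shows "endpoint x' a' \<lless> endpoint x a"
proof -
  obtain f g where fg: "cu_path f" "x' = abs_ihom f" "cu_path g" "x = abs_ihom g"
    by (metis ihom_cases)
  obtain m where m: "m \<in> I\<^sub>Q" "\<And>l. l \<in> I\<^sub>Q \<Longrightarrow> f l \<prec> g m"
    using ihom_way_belowD[OF fg(1,3)] assms(1) fg by blast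
  \<comment> \<open>The level \<open>g m\<close> need not satisfy \<open>g m \<prec> g m\<close>. A
    strictly higher level \<open>n\<close> and an interpolant \<open>b\<close> give the chain
    \<open>f l a' \<le> g m b \<lless> g n a\<close>, which still holds after the supremum over
    \<open>l\<close>.\<close>
  obtain n where n: "n \<in> I\<^sub>Q" "m < n" using IQ_above[OF m(1)] .
  obtain b where b: "a' \<lless> b" "b \<lless> a" using way_below_interpolate[OF assms(2)] .
  have "endpoint x' a' \<le> g m b" unfolding fg(2)
    using endpoint_least[OF fg(1)] way_below_le[OF morph_belowD[OF m(2) b(1)]] by blast
  moreover have "g m b \<lless> g n a" using morph_belowD[OF cu_pathD(2)[OF fg(3) m(1) n] b(2)] .
  ultimately show ?thesis using way_below_mono endpoint_upper[OF fg(3) n(1)] fg(4) by blast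
qed

lemma cu_bimorphism_endpoint: "cu_bimorphism endpoint"
  by (intro cu_bimorphismI endpoint_add_left endpoint_add_right endpoint_zero endpoint_mono
      endpoint_sup endpoint_way_below)

text \<open>Without the way-below assumptions this fails: distinct elements of the internal hom can have
  the same endpoint.\<close>

lemma endpoint_reflects_le:
  assumes "x' \<lless> x" "\<And>a. endpoint x a \<le> endpoint y' a" "y' \<lless> y"
  shows "x' \<le> y"
proof -
  obtain f' f where f: "cu_path f'" "x' = abs_ihom f'" "cu_path f" "x = abs_ihom f"
    by (metis ihom_cases)
  obtain g' g where g: "cu_path g'" "y' = abs_ihom g'" "cu_path g" "y = abs_ihom g"
    by (metis ihom_cases)
  obtain m where m: "m \<in> I\<^sub>Q" "\<And>l. l \<in> I\<^sub>Q \<Longrightarrow> f' l \<prec> f m"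
    using ihom_way_belowD[OF f(1,3)] assms(1) f by blast
  obtain n where n: "n \<in> I\<^sub>Q" "\<And>l. l \<in> I\<^sub>Q \<Longrightarrow> g' l \<prec> g n"
    using ihom_way_belowD[OF g(1,3)] assms(3) g by blast
  \<comment> \<open>The two endpoints are sandwiched between these levels. A pointwise inequality is
    enough, since \<open>\<prec>\<close> absorbs it on the right.\<close>
  have le: "f m a \<le> g n a" for a
  proof -
    have "f m a \<le> endpoint y' a" using endpoint_upper[OF f(3) m(1)] assms(2) f(4) order_trans by blast
    also have "\<dots> \<le> g n a" unfolding g(2)
      by (rule endpoint_least[OF g(1)]) (intro morph_below_le cu_pathD(1) g(1,3) n)
    finally show ?thesis .
  qed
  have "f' l \<prec> g n" if "l \<in> I\<^sub>Q" for l
    unfolding morph_below_def using morph_belowD[OF m(2)[OF that]] le way_below_mono by blast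
  then show ?thesis using f g n(1) by (auto simp: ihom_le path_le_def)
qed


section \<open>Cu-morphisms on tensor products\<close>

lemma gen_cu_morphism_comp:
  assumes f: "gen_cu_morphism f" and g: "gen_cu_morphism g" shows "gen_cu_morphism (g \<circ> f)"
proof -
  note F = gen_cu_morphismD[OF f] and G = gen_cu_morphismD[OF g]
  have "is_sup (range (\<lambda>n. g (f (c n)))) (g (f s))" if "incseq c" "is_sup (range c) s" for c s
    using that by (intro G(4) F(4)) (auto simp: incseq_def intro: F(3))
  then show ?thesis by (auto simp: gen_cu_morphism_def mono_def F(1-3) G(1-3))
qed

lemma gen_cu_bimorphism_comp:
  assumes \<phi>: "gen_cu_bimorphism \<phi>" and f: "gen_cu_morphism f" and g: "gen_cu_morphism g"
  shows "gen_cu_bimorphism (\<lambda>a b. \<phi> (f a) (g b))"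
proof -
  note F = gen_cu_morphismD[OF f] and G = gen_cu_morphismD[OF g] and B = gen_cu_bimorphismD[OF \<phi>]
  have "is_sup (range (\<lambda>n. \<phi> (f (c n)) (g (d n)))) (\<phi> (f s) (g t))"
    if "incseq c" "incseq d" "is_sup (range c) s" "is_sup (range d) t" for c d s t
    using that by (intro B(6) F(4) G(4)) (auto simp: incseq_def intro: F(3) G(3))
  then show ?thesis by (auto simp: gen_cu_bimorphism_def mono_def F(1-3) G(1-3) B(1-5))
qed

lemma cu_bimorphism_comp:
  assumes "cu_bimorphism \<phi>" "cu_morphism f" "cu_morphism g"
  shows "cu_bimorphism (\<lambda>a b. \<phi> (f a) (g b))"
  using assms gen_cu_bimorphism_comp[of \<phi> f g] by (auto simp: cu_bimorphism_def cu_morphism_def)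

text \<open>Pairing with a constant sequence turns joint continuity into continuity in one variable.
  Even for a Cu-bimorphism the result is only a generalized morphism, because \<open>b\<close> need
  not be way below itself.\<close>

lemma gen_cu_bimorphism_left:
  assumes "gen_cu_bimorphism \<phi>" shows "gen_cu_morphism (\<lambda>a. \<phi> a b)"
proof -
  note B = gen_cu_bimorphismD[OF assms]
  have "is_sup (range (\<lambda>n. \<phi> (c n) b)) (\<phi> s b)" if "incseq c" "is_sup (range c) s" for c s
    using that by (intro B(6)[where d = "\<lambda>_. b"]) (auto simp: incseq_def is_sup_iff)
  then show ?thesis by (auto simp: gen_cu_morphism_def mono_def B(1-5))
qed

lemma gen_cu_bimorphism_right:
  assumes "gen_cu_bimorphism \<phi>" shows "gen_cu_morphism (\<phi> a)"
proof -
  note B = gen_cu_bimorphismD[OF assms]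
  have "is_sup (range (\<lambda>n. \<phi> a (c n))) (\<phi> a s)" if "incseq c" "is_sup (range c) s" for c s
    using that by (intro B(6)[where c = "\<lambda>_. a"]) (auto simp: incseq_def is_sup_iff)
  then show ?thesis by (auto simp: gen_cu_morphism_def mono_def B(1-5))
qed

lemma gen_cu_bimorphism_tensor: "gen_cu_bimorphism (\<otimes>)"
  using cu_bimorphismD(1)[OF cu_bimorphism_tensor] .

section \<open>The adjunction between tensor products and internal homs\<close>

text \<open>The definite description denotes because \<open>endpoint (\<alpha> a) b\<close> is a
  Cu-bimorphism in \<open>a\<close> and \<open>b\<close>, which lifts uniquely to the tensor
  product.\<close>

lemma adjunct:
  assumes "cu_morphism \<alpha>"
  shows "cu_morphism (adjunct \<alpha>)" "adjunct \<alpha> (a \<otimes> b) = endpoint (\<alpha> a) b"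
  unfolding atomize_conj adjunct_def
  using theI'[OF gen_cu_bimorphism_lift(2)[of "\<lambda>a b. endpoint (\<alpha> a) b"]]
    cu_bimorphism_comp[OF cu_bimorphism_endpoint assms cu_morphism_id]
  by (auto simp: cu_bimorphism_def)

text \<open>Equal adjuncts yield equal endpoints only. What recovers the elements themselves is that
  both maps preserve the way-below relation, which provides the room demanded by
  \<open>endpoint_reflects_le\<close>.\<close>

lemma adjunct_inj:
  assumes \<alpha>: "cu_morphism \<alpha>" and \<beta>: "cu_morphism \<beta>" and eq: "adjunct \<alpha> = adjunct \<beta>"
  shows "\<alpha> = \<beta>"
proof
  have e: "endpoint (\<alpha> u) a = endpoint (\<beta> u) a" for u a
    using adjunct(2)[OF \<alpha>] adjunct(2)[OF \<beta>] eq by metis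
  have le: "\<gamma> u \<le> \<delta> u" if \<gamma>: "cu_morphism \<gamma>" and \<delta>: "cu_morphism \<delta>"
    and eq: "\<And>u a. endpoint (\<gamma> u) a = endpoint (\<delta> u) a"
  for \<gamma> \<delta> :: "'a \<Rightarrow> ('b, 'c) ihom" and u
  proof -
    have "is_sup (range (\<lambda>n. \<gamma> (approx_seq u n))) (\<gamma> u)"
      using gen_cu_morphismD(4)[OF cu_morphismD(1)[OF \<gamma>] approx_seq_incseq approx_seq_sup] .
    moreover have "\<gamma> (approx_seq u n) \<le> \<delta> u" for n
    proof -
      \<comment> \<open>The endpoints are compared at \<open>v\<close>: \<open>\<gamma>\<close> maps
        \<open>approx_seq u n\<close> way below \<open>\<gamma> v\<close>, and
        \<open>\<delta> v\<close> is way below \<open>\<delta> u\<close>.\<close>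
      obtain v where "approx_seq u n \<lless> v" "v \<lless> u"
        using way_below_interpolate[OF approx_seq_below] .
      then show ?thesis
        using endpoint_reflects_le cu_morphismD(2)[OF \<gamma>] cu_morphismD(2)[OF \<delta>] eq order_refl by metis
    qed
    ultimately show ?thesis using is_sup_least by blast
  qed
  show "\<alpha> u = \<beta> u" for u
    using le[OF \<alpha> \<beta> e] le[OF \<beta> \<alpha> e[symmetric]] by (rule antisym)
qed

lemma evaluation:
  shows "cu_morphism evaluation" "evaluation (x \<otimes> a) = endpoint x a"
  unfolding evaluation_def using adjunct[OF cu_morphism_id] by auto

lemma tensor_map:
  assumes "cu_morphism \<alpha>" "cu_morphism \<beta>"
  shows "cu_morphism (tensor_map \<alpha> \<beta>)" "tensor_map \<alpha> \<beta> (a \<otimes> b) = \<alpha> a \<otimes> \<beta> b"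
proof -
  have b: "cu_bimorphism (\<lambda>a b. \<alpha> a \<otimes> \<beta> b)"
    using cu_bimorphism_comp[OF cu_bimorphism_tensor assms] .
  have "cu_morphism (tensor_map \<alpha> \<beta>) \<and> (\<forall>a b. tensor_map \<alpha> \<beta> (a \<otimes> b) = \<alpha> a \<otimes> \<beta> b)"
    unfolding tensor_map_def
    using theI'[OF gen_cu_bimorphism_lift(2)[OF cu_bimorphismD(1)[OF b] b]] .
  then show "cu_morphism (tensor_map \<alpha> \<beta>)" "tensor_map \<alpha> \<beta> (a \<otimes> b) = \<alpha> a \<otimes> \<beta> b" by auto
qed

section \<open>The associativity map of the tensor product\<close>

text \<open>Uniqueness on elementary tensors is applied twice, the inner time with \<open>c\<close>
  fixed. Generalized morphisms are the right class, since \<open>w \<mapsto> w \<otimes> c\<close>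
  is in general no more than that.\<close>

lemma gen_cu_morphism_tensor3_eq:
  assumes f: "gen_cu_morphism f" and g: "gen_cu_morphism g"
    and eq: "\<And>a b c. f (a \<otimes> b \<otimes> c) = g (a \<otimes> b \<otimes> c)"
  shows "f = g"
proof (rule gen_cu_morphism_tensor_eq[OF f g])
  fix w c
  have comp: "gen_cu_morphism (\<lambda>w. h (w \<otimes> c))" if "gen_cu_morphism h"
    for h :: "(('a, 'b) tensor, 'c) tensor \<Rightarrow> 'd"
    using gen_cu_morphism_comp[OF gen_cu_bimorphism_left[OF gen_cu_bimorphism_tensor] that]
    by (simp add: comp_def)
  show "f (w \<otimes> c) = g (w \<otimes> c)"
    using fun_cong[OF gen_cu_morphism_tensor_eq[OF comp[OF f] comp[OF g] eq], of w] .
qed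

lemma tensor_of_add_mset: "tensor_of (add_mset (a, b) x) = a \<otimes> b + tensor_of x"
  using tensor_of_add[of "{#(a, b)#}" x] by (simp add: tensor_pair_def)

text \<open>The map is built by lifting \<open>(a, b) \<mapsto> a \<otimes> (b \<otimes> c)\<close> for each fixed \<open>c\<close>, which is only a
  generalized Cu-bimorphism; way-below is recovered once \<open>c\<close> varies.\<close>

lemma tensor_assoc_exists:
  obtains h :: "(('a::cu_semigroup, 'b::cu_semigroup) tensor, 'c::cu_semigroup) tensor
      \<Rightarrow> ('a, ('b, 'c) tensor) tensor"
  where "cu_morphism h" "\<And>a b c. h (a \<otimes> b \<otimes> c) = a \<otimes> (b \<otimes> c)"
proof -
  have "\<exists>H::'c \<Rightarrow> ('a, 'b) tensor \<Rightarrow> ('a, ('b, 'c) tensor) tensor.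
      \<forall>c. gen_cu_morphism (H c) \<and> (\<forall>a b. H c (a \<otimes> b) = a \<otimes> (b \<otimes> c))"
  proof (intro choice allI)
    fix c :: 'c
    have "gen_cu_bimorphism (\<lambda>(a::'a) (b::'b). a \<otimes> (b \<otimes> c))"
      using gen_cu_bimorphism_comp[OF gen_cu_bimorphism_tensor gen_cu_morphism_id
          gen_cu_bimorphism_left[OF gen_cu_bimorphism_tensor]] .
    from gen_cu_bimorphism_lift(1)[OF this]
    show "\<exists>h::('a, 'b) tensor \<Rightarrow> ('a, ('b, 'c) tensor) tensor.
        gen_cu_morphism h \<and> (\<forall>a b. h (a \<otimes> b) = a \<otimes> (b \<otimes> c))" by blast
  qed
  then obtain H :: "'c \<Rightarrow> ('a, 'b) tensor \<Rightarrow> ('a, ('b, 'c) tensor) tensor"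
    where gen: "\<And>c. gen_cu_morphism (H c)" and H: "\<And>a b c. H c (a \<otimes> b) = a \<otimes> (b \<otimes> c)"
    by blast
  note T = cu_bimorphismD[OF cu_bimorphism_tensor]
  note B = gen_cu_bimorphismD[OF gen_cu_bimorphism_tensor]
  note G = gen_cu_morphismD[OF gen]
  \<comment> \<open>Order, addition and zero in \<open>c\<close> all come from comparing generalized
    morphisms in \<open>w\<close> on elementary tensors.\<close>
  have mono: "H c w \<le> H c' w'" if "c \<le> c'" "w \<le> w'" for c c' w w'
  proof -
    have "H c w \<le> H c' w"
      by (rule gen_cu_morphism_tensor_le[OF gen gen]) (auto simp: H intro!: B(5) that(1))
    then show ?thesis using G(3)[OF that(2)] order_trans by blast
  qed
  have add: "H (c + c') w = H c w + H c' w" for c c' w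
    by (rule fun_cong[OF gen_cu_morphism_tensor_eq[OF gen gen_cu_morphism_add[OF gen gen]]])
      (simp add: H B(2))
  have zero: "H 0 w = 0" for w
    by (rule fun_cong[OF gen_cu_morphism_tensor_eq[OF gen gen_cu_morphism_zero]])
      (simp add: H B(4))
  \<comment> \<open>Continuity in \<open>c\<close> is first shown at finite sums of elementary
    tensors, where O4 adds up the terms.\<close>
  have sup_of: "is_sup (range (\<lambda>k. H (d k) (tensor_of x))) (H t (tensor_of x))"
    if d: "incseq d" "is_sup (range d) t" for d t x
  proof (induction x)
    case empty
    show ?case by (simp add: tensor_of_empty G(2) is_sup_iff)
  next
    case (add p x)
    obtain a b where p: "p = (a, b)" by (cases p)
    have "is_sup (range (\<lambda>k. a \<otimes> (b \<otimes> d k))) (a \<otimes> (b \<otimes> t))"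
      by (intro gen_cu_morphismD(4)[OF gen_cu_bimorphism_right[OF gen_cu_bimorphism_tensor]] d)
        (auto simp: incseq_def intro!: B(5) incseqD[OF d(1)])
    moreover have "incseq (\<lambda>k. a \<otimes> (b \<otimes> d k))" "incseq (\<lambda>k. H (d k) (tensor_of x))"
      by (auto simp: incseq_def intro!: B(5) mono incseqD[OF d(1)])
    ultimately show ?case
      using O4[OF _ _ _ add] by (simp add: p tensor_of_add_mset G(1) H)
  qed
  have sup: "is_sup (range (\<lambda>k. H (d k) (v k))) (H t w)"
    if d: "incseq v" "incseq d" "is_sup (range v) w" "is_sup (range d) t" for d t v w
  proof (rule is_supI)
    show "y \<le> H t w" if "y \<in> range (\<lambda>k. H (d k) (v k))" for y
      using that is_sup_upper[OF d(3)] is_sup_upper[OF d(4)] by (auto intro!: mono)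
    fix u assume u: "\<And>y. y \<in> range (\<lambda>k. H (d k) (v k)) \<Longrightarrow> y \<le> u"
    obtain x where x: "\<And>n. tensor_below (x n) (x (Suc n))" "incseq (\<lambda>n. tensor_of (x n))"
      "is_sup (range (\<lambda>n. tensor_of (x n))) w"
      using tensor_as_sup[of w] by blast
    show "H t w \<le> u"
    proof (rule is_sup_least[OF G(4)[OF x(2,3)]])
      fix y assume "y \<in> range (\<lambda>n. H t (tensor_of (x n)))"
      then obtain n where n: "y = H t (tensor_of (x n))" by blast
      \<comment> \<open>This relation puts the finite sum below a single \<open>v j\<close>, so that
        the varying \<open>v\<close> can be replaced by a fixed finite sum.\<close>
      have "tensor_of (x n) \<lless> w"
        using way_below_mono[OF order_refl tensor_of_way_below[OF x(1)]] is_sup_upper[OF x(3)] by blast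
      then obtain j where j: "tensor_of (x n) \<le> v j" using way_belowD d(1,3) by blast
      show "y \<le> u" unfolding n
      proof (rule is_sup_least[OF sup_of[OF d(2,4)]])
        fix y assume "y \<in> range (\<lambda>k. H (d k) (tensor_of (x n)))"
        then obtain k where "y = H (d k) (tensor_of (x n))" by blast
        moreover have "tensor_of (x n) \<le> v (max j k)"
          using j incseqD[OF d(1), of j "max j k"] by simp
        ultimately have "y \<le> H (d (max j k)) (v (max j k))"
          by (auto intro!: mono incseqD[OF d(2)])
        also have "\<dots> \<le> u" using u by blast
        finally show "y \<le> u" .
      qed
    qed
  qed
  \<comment> \<open>Passing to \<open>approx_ms z n\<close> shrinks both entries of every pair, and
    \<open>c'\<close> shrinks the third factor. Each summand thus drops way below, and O3 adds the
    summands.\<close>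
  have wb_of: "H c' (tensor_of (approx_ms z n)) \<lless> H c (tensor_of z)" if c: "c' \<lless> c" for c' c z n
  proof (induction z)
    case empty
    show ?case by (simp add: tensor_of_empty G(2) zero_way_below)
  next
    case (add p z)
    obtain a b where p: "p = (a, b)" by (cases p)
    have "approx_seq a n \<otimes> (approx_seq b n \<otimes> c') \<lless> a \<otimes> (b \<otimes> c)"
      by (intro T(2) cu_bimorphismD(2)[OF cu_bimorphism_tensor] approx_seq_below c)
    then show ?case
      using O3[OF _ add] by (simp add: p tensor_of_add_mset G(1) H)
  qed
  have wb: "H c' w' \<lless> H c w" if c: "w' \<lless> w" "c' \<lless> c" for c' c w' w
  proof -
    obtain y where y: "y \<in> ideal_of w" "w' \<le> tensor_of y" using tensor_way_belowD[OF c(1)] .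
    obtain z where z: "z \<in> ideal_of w" "tensor_below y z"
      using y(1) tensor_idealD(3)[OF ideal_of_ideal] by blast
    \<comment> \<open>This brings \<open>w'\<close> below a termwise approximation of one
      \<open>z\<close> in the ideal of \<open>w\<close>, the case settled by
      \<open>wb_of\<close>.\<close>
    obtain n where "y \<preceq> approx_ms z n" using z(2) tensor_below_iff by blast
    then have "w' \<le> tensor_of (approx_ms z n)" using tensor_of_mono y(2) order_trans by blast
    then show ?thesis
      using way_below_mono[OF mono[OF order_refl] wb_of[OF c(2)] mono[OF order_refl tensor_of_le[OF z(1)]]]
      by blast
  qed
  have "cu_bimorphism (\<lambda>w c. H c w)"
    by (intro cu_bimorphismI mono sup wb) (simp_all add: G(1,2) add zero)
  then obtain h where "cu_morphism h" "\<And>w c. h (w \<otimes> c) = H c w"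
    using gen_cu_bimorphism_lift(2) cu_bimorphismD(1) by blast
  then show thesis using that H by simp
qed

lemma tensor_assoc:
  shows "cu_morphism (tensor_assoc ::
      (('a::cu_semigroup, 'b::cu_semigroup) tensor, 'c::cu_semigroup) tensor \<Rightarrow> _)"
    and "tensor_assoc ((a::'a) \<otimes> (b::'b) \<otimes> (c::'c)) = a \<otimes> (b \<otimes> c)"
proof -
  obtain h :: "(('a, 'b) tensor, 'c) tensor \<Rightarrow> ('a, ('b, 'c) tensor) tensor"
    where h: "cu_morphism h" "\<And>a b c. h (a \<otimes> b \<otimes> c) = a \<otimes> (b \<otimes> c)"
    using tensor_assoc_exists by blast
  have "tensor_assoc = h" unfolding tensor_assoc_def
    using h by (intro the_equality) (auto intro!: gen_cu_morphism_tensor3_eq dest: cu_morphismD(1))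
  then show "cu_morphism (tensor_assoc :: (('a, 'b) tensor, 'c) tensor \<Rightarrow> _)"
    "tensor_assoc (a \<otimes> b \<otimes> c) = a \<otimes> (b \<otimes> c)" using h by auto
qed


section \<open>The composition product\<close>

lemma morph_below_comp: "f' \<prec> f \<Longrightarrow> g' \<prec> g \<Longrightarrow> g' \<circ> f' \<prec> g \<circ> f"
  by (auto simp: morph_below_def)

lemma cu_path_comp: "cu_path f \<Longrightarrow> cu_path g \<Longrightarrow> cu_path (\<lambda>l. g l \<circ> f l)"
  by (auto simp: cu_path_def gen_cu_morphism_comp morph_below_comp)

lemma cu_path_upper:
  assumes "cu_path f" "cu_path g" "m \<in> I\<^sub>Q" "n \<in> I\<^sub>Q"
  obtains k where "k \<in> I\<^sub>Q" "f m \<prec> f k" "g n \<prec> g k"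
proof -
  obtain k where "k \<in> I\<^sub>Q" "max m n < k"
    using IQ_above[of "max m n"] assms(3,4) by (metis max_def)
  then show thesis using that assms cu_pathD(2) by (metis max_less_iff_conj)
qed

lemma path_le_comp:
  assumes "cu_path f'" "cu_path g'" "f \<lesssim> f'" "g \<lesssim> g'"
  shows "(\<lambda>l. g l \<circ> f l) \<lesssim> (\<lambda>l. g' l \<circ> f' l)"
  unfolding path_le_def
proof
  fix l assume "l \<in> I\<^sub>Q"
  then obtain m n where mn: "m \<in> I\<^sub>Q" "f l \<prec> f' m" "n \<in> I\<^sub>Q" "g l \<prec> g' n"
    using assms(3,4) unfolding path_le_def by blast
  obtain k where "k \<in> I\<^sub>Q" "f' m \<prec> f' k" "g' n \<prec> g' k"
    using cu_path_upper[OF assms(1,2) mn(1,3)] .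
  then show "\<exists>k\<in>I\<^sub>Q. g l \<circ> f l \<prec> g' k \<circ> f' k"
    using mn morph_below_comp morph_below_trans by blast
qed

text \<open>An explicit model of the composition product, identified with it in
  \<open>composition_tensor\<close>.\<close>

lift_definition ihom_comp ::
    "('b::cu_semigroup, 'c::cu_semigroup) ihom \<Rightarrow> ('a::cu_semigroup, 'b) ihom \<Rightarrow> ('a, 'c) ihom"
  is "\<lambda>g f l. g l \<circ> f l"
  by (auto simp: path_equiv_def cu_path_comp path_le_comp)

lemma ihom_comp_abs:
  "cu_path g \<Longrightarrow> cu_path f \<Longrightarrow> ihom_comp (abs_ihom g) (abs_ihom f) = abs_ihom (\<lambda>l. g l \<circ> f l)"
  by (simp add: ihom_comp.abs_eq path_equiv_refl)

text \<open>Levels outside \<open>I\<^sub>Q\<close> are arbitrary functions, so identities that rest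
  on the morphism laws hold only at indices in \<open>I\<^sub>Q\<close>. The class does not see the
  other indices.\<close>

lemma abs_ihom_eqI:
  assumes f: "cu_path f" and g: "cu_path g" and eq: "\<And>l. l \<in> I\<^sub>Q \<Longrightarrow> f l = g l"
  shows "abs_ihom f = abs_ihom g"
proof (rule antisym)
  show "abs_ihom f \<le> abs_ihom g" "abs_ihom g \<le> abs_ihom f"
    using f g eq path_le_refl[OF f] path_le_refl[OF g] by (auto simp: ihom_le path_le_def)
qed

lemma endpoint_comp: "endpoint (ihom_comp y x) a = endpoint y (endpoint x a)"
proof -
  obtain f g where fg: "cu_path f" "x = abs_ihom f" "cu_path g" "y = abs_ihom g"
    by (metis ihom_cases)
  have "endpoint (abs_ihom (\<lambda>l. g l \<circ> f l)) a \<le> endpoint y (endpoint x a)"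
  proof (rule endpoint_least[OF cu_path_comp[OF fg(1,3)]])
    fix l assume l: "l \<in> I\<^sub>Q"
    have "g l (f l a) \<le> endpoint y (f l a)" using endpoint_upper[OF fg(3) l] fg(4) by simp
    also have "\<dots> \<le> endpoint y (endpoint x a)"
      using endpoint_upper[OF fg(1) l] fg(2) by (intro endpoint_mono) simp_all
    finally show "(g l \<circ> f l) a \<le> endpoint y (endpoint x a)" by simp
  qed
  moreover have "endpoint y (endpoint x a) \<le> endpoint (abs_ihom (\<lambda>l. g l \<circ> f l)) a"
    unfolding fg(4)
  proof (rule endpoint_least[OF fg(3)])
    fix l assume l: "l \<in> I\<^sub>Q"
    have "is_sup (range (\<lambda>n. g l (f (cut_point n) a))) (g l (endpoint x a))"
      unfolding fg(2)
      by (intro gen_cu_morphismD(4)[OF cu_pathD(1)[OF fg(3) l]] cut_point_incseq fg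
          endpoint_is_sup_cut)
    then show "g l (endpoint x a) \<le> endpoint (abs_ihom (\<lambda>l. g l \<circ> f l)) a"
    proof (rule is_sup_least)
      fix y assume "y \<in> range (\<lambda>n. g l (f (cut_point n) a))"
      then obtain n where n: "y = g l (f (cut_point n) a)" by blast
      \<comment> \<open>The outer level \<open>l\<close> and the inner level
        \<open>cut_point n\<close> are merged into one, since the composite path has only diagonal
        levels.\<close>
      define k where "k = max l (cut_point n)"
      have k: "k \<in> I\<^sub>Q" "l \<le> k" "cut_point n \<le> k"
        using l cut_point_IQ[of n] by (auto simp: k_def max_def)
      have "y \<le> g l (f k a)"
        unfolding n using gen_cu_morphismD(3)[OF cu_pathD(1)[OF fg(3) l]]
          path_mono[OF fg(1) cut_point_IQ k(1,3)] .
      also have "\<dots> \<le> g k (f k a)" using path_mono[OF fg(3) l k(1,2)] .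
      also have "\<dots> \<le> endpoint (abs_ihom (\<lambda>l. g l \<circ> f l)) a"
        using endpoint_upper[OF cu_path_comp[OF fg(1,3)] k(1), of a] by simp
      finally show "y \<le> endpoint (abs_ihom (\<lambda>l. g l \<circ> f l)) a" .
    qed
  qed
  ultimately show ?thesis unfolding fg(2,4) ihom_comp_abs[OF fg(3,1)] by (rule antisym)
qed

section \<open>Levelwise composition as a Cu-bimorphism\<close>

lemma ihom_comp_mono:
  assumes "y \<le> y'" "x \<le> x'" shows "ihom_comp y x \<le> ihom_comp y' x'"
proof -
  obtain f f' g g' where fg: "cu_path f" "x = abs_ihom f" "cu_path f'" "x' = abs_ihom f'"
    "cu_path g" "y = abs_ihom g" "cu_path g'" "y' = abs_ihom g'"
    by (metis ihom_cases)
  then show ?thesis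
    using assms by (simp add: ihom_comp_abs ihom_le cu_path_comp path_le_comp)
qed

lemma ihom_comp_add_left: "ihom_comp (y + y') x = ihom_comp y x + ihom_comp y' x"
proof -
  obtain f g g' where fg: "cu_path f" "x = abs_ihom f" "cu_path g" "y = abs_ihom g"
    "cu_path g'" "y' = abs_ihom g'"
    by (metis ihom_cases)
  have "abs_ihom (\<lambda>l. (\<lambda>a. g l a + g' l a) \<circ> f l) = abs_ihom (\<lambda>l a. (g l \<circ> f l) a + (g' l \<circ> f l) a)"
    by (simp add: comp_def)
  then show ?thesis by (simp add: fg ihom_comp_abs ihom_add cu_path_add cu_path_comp del: comp_apply)
qed

text \<open>Unlike additivity on the left, which is pure unfolding, this uses that each
  \<open>g l\<close> is additive, hence the comparison restricted to
  \<open>I\<^sub>Q\<close>.\<close>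

lemma ihom_comp_add_right: "ihom_comp y (x + x') = ihom_comp y x + ihom_comp y x'"
proof -
  obtain f f' g where fg: "cu_path f" "x = abs_ihom f" "cu_path f'" "x' = abs_ihom f'"
    "cu_path g" "y = abs_ihom g"
    by (metis ihom_cases)
  have "abs_ihom (\<lambda>l. g l \<circ> (\<lambda>a. f l a + f' l a)) = abs_ihom (\<lambda>l a. (g l \<circ> f l) a + (g l \<circ> f' l) a)"
    using gen_cu_morphismD(1)[OF cu_pathD(1)[OF fg(5)]]
    by (intro abs_ihom_eqI cu_path_comp cu_path_add fg) auto
  then show ?thesis by (simp add: fg ihom_comp_abs ihom_add cu_path_add cu_path_comp)
qed

lemma ihom_comp_zero: "ihom_comp 0 x = 0" "ihom_comp y 0 = 0"
proof -
  obtain f where f: "cu_path f" "x = abs_ihom f" by (rule ihom_cases)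
  show "ihom_comp 0 x = 0"
    unfolding zero_ihom_def f(2) ihom_comp_abs[OF cu_path_zero f(1)] by (simp add: comp_def)
  obtain g where g: "cu_path g" "y = abs_ihom g" by (rule ihom_cases)
  show "ihom_comp y 0 = 0"
    unfolding zero_ihom_def g(2) ihom_comp_abs[OF g(1) cu_path_zero]
    using gen_cu_morphismD(2)[OF cu_pathD(1)[OF g(1)]]
    by (intro abs_ihom_eqI cu_path_comp cu_path_zero g) auto
qed

lemma ihom_comp_sup:
  assumes c: "incseq c" "incseq d" "is_sup (range c) s" "is_sup (range d) t"
  shows "is_sup (range (\<lambda>k. ihom_comp (c k) (d k))) (ihom_comp s t)"
proof (rule is_supI)
  show "x \<le> ihom_comp s t" if "x \<in> range (\<lambda>k. ihom_comp (c k) (d k))" for x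
    using that is_sup_upper[OF c(3)] is_sup_upper[OF c(4)] by (auto intro!: ihom_comp_mono)
  fix u assume u: "\<And>x. x \<in> range (\<lambda>k. ihom_comp (c k) (d k)) \<Longrightarrow> x \<le> u"
  obtain G where G: "\<And>k. cu_path (G k)" "\<And>k. c k = abs_ihom (G k)" using ihom_seq_paths[of c] by blast
  obtain F where F: "\<And>k. cu_path (F k)" "\<And>k. d k = abs_ihom (F k)" using ihom_seq_paths[of d] by blast
  obtain H where H: "cu_path H" "is_sup (range c) (abs_ihom H)"
    "\<And>l. l \<in> I\<^sub>Q \<Longrightarrow> \<exists>k. \<exists>m\<in>I\<^sub>Q. H l = G k m"
    using ihom_sup_path[OF c(1) G] by blast
  obtain K where K: "cu_path K" "is_sup (range d) (abs_ihom K)"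
    "\<And>l. l \<in> I\<^sub>Q \<Longrightarrow> \<exists>k. \<exists>m\<in>I\<^sub>Q. K l = F k m"
    using ihom_sup_path[OF c(2) F] by blast
  obtain h where h: "cu_path h" "u = abs_ihom h" by (rule ihom_cases)
  have "\<exists>p\<in>I\<^sub>Q. H l \<circ> K l \<prec> h p" if l: "l \<in> I\<^sub>Q" for l
  proof -
    obtain i m where i: "m \<in> I\<^sub>Q" "H l = G i m" using H(3)[OF l] by blast
    obtain j n where j: "n \<in> I\<^sub>Q" "K l = F j n" using K(3)[OF l] by blast
    \<comment> \<open>Two alignments are required: first of the sequence indices \<open>i\<close>
      and \<open>j\<close> to \<open>k\<close>, then of the levels \<open>m'\<close> and
      \<open>n'\<close> to \<open>p\<close>. Only then does the bound \<open>u\<close> on the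
      diagonal composite apply.\<close>
    define k where "k = max i j"
    have "c i \<le> c k" "d j \<le> d k" using c(1,2) by (auto simp: k_def incseq_def)
    then have "G i \<lesssim> G k" "F j \<lesssim> F k" using F G ihom_le by metis+
    then obtain m' n' where mn: "m' \<in> I\<^sub>Q" "G i m \<prec> G k m'" "n' \<in> I\<^sub>Q" "F j n \<prec> F k n'"
      using i(1) j(1) unfolding path_le_def by blast
    obtain p where p: "p \<in> I\<^sub>Q" "F k n' \<prec> F k p" "G k m' \<prec> G k p"
      using cu_path_upper[OF F(1) G(1) mn(3,1)] .
    have "H l \<circ> K l \<prec> G k p \<circ> F k p"
      unfolding i(2) j(2) using morph_below_comp morph_below_trans mn p by metis
    moreover have "abs_ihom (\<lambda>l. G k l \<circ> F k l) \<le> abs_ihom h"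
      using u[of "ihom_comp (c k) (d k)"] G F h by (simp add: ihom_comp_abs)
    then have "(\<lambda>l. G k l \<circ> F k l) \<lesssim> h" using ihom_le[OF cu_path_comp[OF F(1) G(1)] h(1)] by blast
    ultimately show ?thesis using p(1) morph_below_trans unfolding path_le_def by blast
  qed
  then have "ihom_comp (abs_ihom H) (abs_ihom K) \<le> abs_ihom h"
    using H K h by (simp add: ihom_comp_abs ihom_le cu_path_comp path_le_def)
  then show "ihom_comp s t \<le> u" using c(3,4) H(2) K(2) h is_sup_unique by metis
qed

text \<open>Way-below in the internal hom means that one level of the larger path dominates all
  levels of the smaller one. The dominating levels of the two factors are raised to a common
  \<open>k\<close>.\<close>

lemma ihom_comp_way_below:
  assumes "y' \<lless> y" "x' \<lless> x" shows "ihom_comp y' x' \<lless> ihom_comp y x"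
proof -
  obtain f f' g g' where fg: "cu_path f" "x = abs_ihom f" "cu_path f'" "x' = abs_ihom f'"
    "cu_path g" "y = abs_ihom g" "cu_path g'" "y' = abs_ihom g'"
    by (metis ihom_cases)
  obtain m where m: "m \<in> I\<^sub>Q" "\<And>l. l \<in> I\<^sub>Q \<Longrightarrow> f' l \<prec> f m"
    using ihom_way_belowD[OF fg(3,1)] assms fg by blast
  obtain n where n: "n \<in> I\<^sub>Q" "\<And>l. l \<in> I\<^sub>Q \<Longrightarrow> g' l \<prec> g n"
    using ihom_way_belowD[OF fg(7,5)] assms fg by blast
  obtain k where k: "k \<in> I\<^sub>Q" "f m \<prec> f k" "g n \<prec> g k"
    using cu_path_upper[OF fg(1,5) m(1) n(1)] .
  have "g' l \<circ> f' l \<prec> g k \<circ> f k" if "l \<in> I\<^sub>Q" for l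
    by (rule morph_below_comp) (use m(2) n(2) k that morph_below_trans in blast)+
  then show ?thesis
    unfolding fg(2,4,6,8) ihom_comp_abs[OF fg(5,1)] ihom_comp_abs[OF fg(7,3)]
    by (intro ihom_way_belowI[OF _ _ k(1)] cu_path_comp fg) auto
qed

lemma cu_bimorphism_ihom_comp: "cu_bimorphism ihom_comp"
  by (intro cu_bimorphismI ihom_comp_add_left ihom_comp_add_right ihom_comp_zero ihom_comp_mono
      ihom_comp_sup ihom_comp_way_below)

section \<open>Identification with the composition product\<close>

text \<open>The lift \<open>\<gamma>\<close> of \<open>ihom_comp\<close> has the adjunct prescribed
  for \<open>composition\<close>: on triple tensors both maps give
  \<open>endpoint y (endpoint x a)\<close>. By \<open>adjunct_inj\<close> it is the only such
  Cu-morphism.\<close>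

lemma composition_tensor:
  fixes y :: "('b::cu_semigroup, 'c::cu_semigroup) ihom" and x :: "('a::cu_semigroup, 'b) ihom"
  shows "composition (y \<otimes> x) = ihom_comp y x"
proof -
  obtain \<gamma> :: "(('b, 'c) ihom, ('a, 'b) ihom) tensor \<Rightarrow> ('a, 'c) ihom"
    where \<gamma>: "cu_morphism \<gamma>" "\<And>y x. \<gamma> (y \<otimes> x) = ihom_comp y x"
    using gen_cu_bimorphism_lift(2)[OF cu_bimorphismD(1)[OF cu_bimorphism_ihom_comp]
      cu_bimorphism_ihom_comp] by blast
  let ?h = "evaluation \<circ> tensor_map id evaluation \<circ> tensor_assoc ::
    ((('b, 'c) ihom, ('a, 'b) ihom) tensor, 'a) tensor \<Rightarrow> 'c"
  have adj: "adjunct \<gamma> = ?h"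
  proof (rule gen_cu_morphism_tensor3_eq)
    show "gen_cu_morphism (adjunct \<gamma>)" using cu_morphismD(1)[OF adjunct(1)[OF \<gamma>(1)]] .
    show "gen_cu_morphism ?h"
      by (intro gen_cu_morphism_comp cu_morphismD(1) evaluation tensor_map tensor_assoc
          cu_morphism_id)
    show "adjunct \<gamma> (y \<otimes> x \<otimes> a) = ?h (y \<otimes> x \<otimes> a)" for y x a
      by (simp add: adjunct(2)[OF \<gamma>(1)] \<gamma>(2) endpoint_comp tensor_assoc(2)
          tensor_map(2)[OF cu_morphism_id evaluation(1)] evaluation(2))
  qed
  have "composition = \<gamma>"
    unfolding composition_def
    by (rule the_equality) (use \<gamma>(1) adj in \<open>auto intro: adjunct_inj\<close>)
  then show ?thesis using \<gamma>(2) by simp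
qed

section \<open>Semiring and action laws\<close>

lemma cu_path_id: "cu_path (\<lambda>_. id)"
  by (auto simp: cu_path_def morph_below_def cu_morphismD(1)[OF cu_morphism_id])

lemma ihom_comp_assoc: "ihom_comp (ihom_comp z y) x = ihom_comp z (ihom_comp y x)"
proof -
  obtain f g h where "cu_path f" "x = abs_ihom f" "cu_path g" "y = abs_ihom g"
    "cu_path h" "z = abs_ihom h"
    by (metis ihom_cases)
  then show ?thesis by (simp add: ihom_comp_abs cu_path_comp comp_assoc)
qed

lemma ihom_comp_id: "ihom_comp x (hom_class id) = x" "ihom_comp (hom_class id) x = x"
proof -
  obtain f where "cu_path f" "x = abs_ihom f" by (rule ihom_cases)
  then show "ihom_comp x (hom_class id) = x" "ihom_comp (hom_class id) x = x"
    by (simp_all add: hom_class_def ihom_comp_abs cu_path_id)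
qed

lemma endpoint_id: "endpoint (hom_class id) a = a"
proof -
  have "is_sup (range (\<lambda>n::nat. a)) (endpoint (hom_class id) a)"
    using endpoint_is_sup_cut[OF cu_path_id, of a] by (simp add: hom_class_def)
  then show ?thesis by (auto intro: is_sup_unique simp: is_sup_iff)
qed

theorem proposition5p3:
  shows "cu_left_action
    (\<lambda>y x :: ('s::cu_semigroup, 's) ihom. composition (y \<otimes> x))
    (hom_class id)
    (\<lambda>(x :: ('s, 's) ihom) (a :: 's). evaluation (x \<otimes> a))"
  \<comment> \<open>Product and action become \<open>ihom_comp\<close> and \<open>endpoint\<close>,
    so the action law is \<open>endpoint_comp\<close> and the unit law
    \<open>endpoint_id\<close>.\<close>
  unfolding composition_tensor evaluation(2)
  by unfold_locales
    (simp_all add: cu_bimorphism_ihom_comp cu_bimorphism_endpoint ihom_comp_assoc ihom_comp_id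
      endpoint_comp endpoint_id)

end
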